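(* Let $F$ be a field of characteristic not $2$ and $r\ge1$ an integer, and let $k$ be the unique natural number with $\nu_2((2k-2)!)<r\le\nu_2((2k)!)$. Suppose $2^rW_t(F)=0$ and $2^{r-1}(I_t(F))^{2k-1}\neq0$. Then $A'_t(F)=J'_{e,r}$, where $J'_{e,r}$ is the ideal of $\mathbb{Z}[X]$ generated by \[2^rX,\quad 2^{r-\nu_2((2i)!)}X^{2i}\ (1\le i\le k-1),\quad X^{2k}.\]
   Context: $W(F)$ is the Witt ring of nonsingular quadratic forms over $F$, $W_t(F)$ its torsion subgroup, $I(F)$ the fundamental ideal of even-dimensional forms, and $I_t(F)=I(F)\cap W_t(F)$, an ideal of $W(F)$; $(I_t(F))^{m}$ is its $m$-th power as an ideal and $2^{r-1}(I_t(F))^{2k-1}$ is the set of $2^{r-1}$-multiples of its elements. A polynomial $f=\sum c_iX^i\in\mathbb{Z}[X]$ is evaluated at $\phi\in W(F)$ as $f(\phi)=\sum_i c_i\phi^i$ (integer multiples via orthogonal sums, powers via tensor products, $\phi^0=\langle1\rangle$). The torsion annihilator ideal is $A_t(F)=\{f\in\mathbb{Z}[X]: f(\phi)=0\text{ for all }\phi\in I_t(F)\}$, and $A'_t(F)=A_t(F)\cap X\mathbb{Z}[X]$. $\nu_2$ is the $2$-adic valuation. *)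

theory Defs
  imports "Jordan_Normal_Form.Determinant" "HOL-Computational_Algebra.Computational_Algebra"
begin

class field_char_neq_2 = field +
  assumes two_neq_zero: "2 \<noteq> (0::'a)"

lemma CHAR_neq_2: "CHAR('a::field_char_neq_2) \<noteq> 2"
proof
  assume "CHAR('a) = 2"
  then have "of_nat 2 = (0::'a)" by (metis of_nat_CHAR)
  then show False using two_neq_zero[where 'a='a] by simp
qed

text \<open>
  Over a field of characteristic not 2, an \<open>n\<close>-dimensional quadratic form is given by its
  symmetric Gram matrix \<open>A\<close>, the form being \<open>x \<mapsto> x \<bullet> (A *\<^sub>v x)\<close>.  It is nonsingular iff
  \<open>det A \<noteq> 0\<close>, and isometry of forms is congruence of Gram matrices.  Dimension 0 is allowed.
\<close>

definition nonsingular_form :: "'a::field mat \<Rightarrow> bool" where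
  "nonsingular_form A \<longleftrightarrow> square_mat A \<and> A\<^sup>T = A \<and> det A \<noteq> 0"

definition isometric :: "'a::field mat \<Rightarrow> 'a mat \<Rightarrow> bool" where
  "isometric A B \<longleftrightarrow> square_mat A \<and> square_mat B \<and> dim_row A = dim_row B \<and>
     (\<exists>P \<in> carrier_mat (dim_row A) (dim_row A). det P \<noteq> 0 \<and> A = P\<^sup>T * B * P)"

definition unary_form :: "'a \<Rightarrow> 'a mat" where
  "unary_form a = mat 1 1 (\<lambda>_. a)"

definition orth_sum :: "'a::zero mat \<Rightarrow> 'a mat \<Rightarrow> 'a mat" where
  "orth_sum A B =
     four_block_mat A (0\<^sub>m (dim_row A) (dim_col B)) (0\<^sub>m (dim_row B) (dim_col A)) B"

text \<open>The Gram matrix of a tensor product of forms is the Kronecker product.\<close>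

definition tensor_form :: "'a::times mat \<Rightarrow> 'a mat \<Rightarrow> 'a mat" where
  "tensor_form A B = mat (dim_row A * dim_row B) (dim_col A * dim_col B)
     (\<lambda>(i, j). A $$ (i div dim_row B, j div dim_col B) * B $$ (i mod dim_row B, j mod dim_col B))"

definition hyperbolic_plane :: "'a::field mat" where
  "hyperbolic_plane = orth_sum (unary_form 1) (unary_form (- 1))"

fun hyperbolic_form :: "nat \<Rightarrow> 'a::field mat" where
  "hyperbolic_form 0 = 0\<^sub>m 0 0"
| "hyperbolic_form (Suc n) = orth_sum hyperbolic_plane (hyperbolic_form n)"

definition witt_equiv :: "'a::field mat \<Rightarrow> 'a mat \<Rightarrow> bool" where
  "witt_equiv A B \<longleftrightarrow> nonsingular_form A \<and> nonsingular_form B \<and>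
     (\<exists>m n. isometric (orth_sum A (hyperbolic_form m)) (orth_sum B (hyperbolic_form n)))"

lemma mult_square_carrier:
  "A \<in> carrier_mat n n \<Longrightarrow> B \<in> carrier_mat n n \<Longrightarrow> A * B \<in> carrier_mat n n"
  by (rule mult_carrier_mat)

lemma det_nonzero_inverse:
  fixes A :: "'a::field mat"
  assumes "A \<in> carrier_mat n n" "det A \<noteq> 0"
  obtains B where "B \<in> carrier_mat n n" "A * B = 1\<^sub>m n" "B * A = 1\<^sub>m n"
  using det_non_zero_imp_unit[OF assms, of "()"]
  by (auto simp: Units_def ring_mat_def)

lemma inverse_det_nonzero:
  fixes A :: "'a::field mat"
  assumes "A \<in> carrier_mat n n" "B \<in> carrier_mat n n" "A * B = 1\<^sub>m n"
  shows "det A \<noteq> 0"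
  using det_mult[OF assms(1,2)] assms(3) by auto

lemma isometricI:
  assumes "A \<in> carrier_mat n n" "B \<in> carrier_mat n n" "P \<in> carrier_mat n n"
    "det P \<noteq> 0" "A = P\<^sup>T * B * P"
  shows "isometric A B"
  using assms unfolding isometric_def by (auto intro!: bexI[of _ P])

lemma isometricE:
  assumes "isometric A B"
  obtains n P where "A \<in> carrier_mat n n" "B \<in> carrier_mat n n" "P \<in> carrier_mat n n"
    "det P \<noteq> 0" "A = P\<^sup>T * B * P"
proof -
  from assms obtain P where P: "P \<in> carrier_mat (dim_row A) (dim_row A)" "det P \<noteq> 0"
     "A = P\<^sup>T * B * P" and sq: "square_mat A" "square_mat B" "dim_row A = dim_row B"
    unfolding isometric_def by blast
  have "A \<in> carrier_mat (dim_row A) (dim_row A)" "B \<in> carrier_mat (dim_row A) (dim_row A)"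
    using sq by auto
  then show ?thesis using P by (rule that)
qed

lemma isometric_refl: "A \<in> carrier_mat n n \<Longrightarrow> isometric A A"
  by (rule isometricI[of _ n _ "1\<^sub>m n"]) auto

lemma isometric_dim: "isometric A B \<Longrightarrow> dim_row A = dim_row B"
  by (simp add: isometric_def)

lemma isometric_sym:
  assumes "isometric A B"
  shows "isometric B A"
proof -
  from assms obtain n P where c[simp]: "A \<in> carrier_mat n n" "B \<in> carrier_mat n n" "P \<in> carrier_mat n n"
    and d: "det P \<noteq> 0" and A: "A = P\<^sup>T * B * P" by (rule isometricE)
  from det_nonzero_inverse[OF c(3) d] obtain Q where Q[simp]: "Q \<in> carrier_mat n n"
    and PQ: "P * Q = 1\<^sub>m n" "Q * P = 1\<^sub>m n" by blast
  have T: "Q\<^sup>T * P\<^sup>T = 1\<^sub>m n"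
    using transpose_mult[OF c(3) Q] PQ(1) by simp
  have "Q\<^sup>T * A * Q = Q\<^sup>T * (P\<^sup>T * B * P * Q)"
    unfolding A by (rule assoc_mult_mat[of _ n n _ n _ n]) (auto simp: mult_square_carrier)
  also have "P\<^sup>T * B * P * Q = P\<^sup>T * B * (P * Q)"
    by (rule assoc_mult_mat[of _ n n _ n _ n]) (auto simp: mult_square_carrier)
  also have "\<dots> = P\<^sup>T * B" unfolding PQ
    by (rule right_mult_one_mat[of _ n n]) (auto simp: mult_square_carrier)
  also have "Q\<^sup>T * (P\<^sup>T * B) = Q\<^sup>T * P\<^sup>T * B"
    by (rule assoc_mult_mat[of _ n n _ n _ n, symmetric]) auto
  also have "\<dots> = B" unfolding T by (rule left_mult_one_mat[OF c(2)])
  finally have "B = Q\<^sup>T * A * Q" ..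
  moreover have "det Q \<noteq> 0" by (rule inverse_det_nonzero[OF Q c(3) PQ(2)])
  ultimately show ?thesis by (intro isometricI[OF c(2) c(1) Q]) auto
qed

lemma isometric_trans [trans]:
  assumes "isometric A B" "isometric B C"
  shows "isometric A C"
proof -
  from assms(1) obtain n P where c[simp]: "A \<in> carrier_mat n n" "B \<in> carrier_mat n n" "P \<in> carrier_mat n n"
    and d: "det P \<noteq> 0" and A: "A = P\<^sup>T * B * P" by (rule isometricE)
  from assms(2) obtain n' Q where "B \<in> carrier_mat n' n'" "C \<in> carrier_mat n' n'" "Q \<in> carrier_mat n' n'"
    and d': "det Q \<noteq> 0" and B: "B = Q\<^sup>T * C * Q" by (rule isometricE)
  then have c'[simp]: "C \<in> carrier_mat n n" "Q \<in> carrier_mat n n" using c(2) by auto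
  have [simp]: "Q * P \<in> carrier_mat n n" by (rule mult_carrier_mat[of _ n n]) auto
  have "(Q * P)\<^sup>T * C * (Q * P) = (P\<^sup>T * Q\<^sup>T) * C * (Q * P)"
    by (subst transpose_mult[OF c'(2) c(3)]) simp
  also have "\<dots> = (P\<^sup>T * (Q\<^sup>T * C)) * (Q * P)"
    by (subst assoc_mult_mat[of _ n n _ n _ n]) auto
  also have "\<dots> = P\<^sup>T * (Q\<^sup>T * C * (Q * P))"
    by (rule assoc_mult_mat[of _ n n _ n _ n]) (auto simp: mult_square_carrier)
  also have "Q\<^sup>T * C * (Q * P) = Q\<^sup>T * C * Q * P"
    by (rule assoc_mult_mat[of _ n n _ n _ n, symmetric]) (auto simp: mult_square_carrier)
  also have "P\<^sup>T * (Q\<^sup>T * C * Q * P) = P\<^sup>T * B * P" unfolding B[symmetric]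
    by (rule assoc_mult_mat[of _ n n _ n _ n, symmetric]) auto
  finally have "A = (Q * P)\<^sup>T * C * (Q * P)" using A by simp
  moreover have "det (Q * P) \<noteq> 0" using det_mult[OF c'(2) c(3)] d d' by simp
  ultimately show ?thesis by (intro isometricI[OF c(1) c'(1), of "Q * P"]) auto
qed

lemma isometric_reindex:
  fixes A :: "'a::field mat"
  assumes A: "A \<in> carrier_mat n n" and f: "\<And>i. i < n \<Longrightarrow> f i < n" "inj_on f {..<n}"
    and B: "B \<in> carrier_mat n n" "\<And>i j. i < n \<Longrightarrow> j < n \<Longrightarrow> B $$ (i, j) = A $$ (f i, f j)"
  shows "isometric B A"
proof -
  define P :: "'a mat" where "P = mat n n (\<lambda>(i, j). if i = f j then 1 else 0)"
  have P[simp]: "P \<in> carrier_mat n n" unfolding P_def by simp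
  have 1: "P\<^sup>T * P = 1\<^sub>m n"
  proof (rule eq_matI)
    fix i j assume "i < dim_row (1\<^sub>m n :: 'a mat)" "j < dim_col (1\<^sub>m n :: 'a mat)"
    then have ij: "i < n" "j < n" by auto
    have "(P\<^sup>T * P) $$ (i, j) = (\<Sum>k = 0..<n. (if k = f i then 1 else 0) * (if k = f j then 1 else 0))"
      using ij by (simp add: P_def scalar_prod_def)
    also have "\<dots> = (\<Sum>k = 0..<n. if k = f i then (if f i = f j then 1 else 0) else 0)"
      by (rule sum.cong) auto
    also have "\<dots> = (if f i = f j then 1 else 0)" using f(1)[OF ij(1)] by simp
    also have "\<dots> = (1\<^sub>m n) $$ (i, j)" using ij inj_onD[OF f(2), of i j] by auto
    finally show "(P\<^sup>T * P) $$ (i, j) = (1\<^sub>m n) $$ (i, j)" .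
  qed (auto simp: P_def)
  have "det P\<^sup>T \<noteq> 0" by (rule inverse_det_nonzero[OF _ P 1]) simp
  then have d: "det P \<noteq> 0" using det_transpose[OF P] by simp
  have "B = P\<^sup>T * A * P"
  proof (rule eq_matI)
    fix i j assume "i < dim_row (P\<^sup>T * A * P)" "j < dim_col (P\<^sup>T * A * P)"
    then have ij: "i < n" "j < n" by (auto simp: P_def)
    have PA: "(P\<^sup>T * A) $$ (i, l) = A $$ (f i, l)" if "l < n" for l
    proof -
      have "(P\<^sup>T * A) $$ (i, l) = (\<Sum>k = 0..<n. (if k = f i then 1 else 0) * A $$ (k, l))"
        using ij that A by (simp add: P_def scalar_prod_def)
      also have "\<dots> = (\<Sum>k = 0..<n. if k = f i then A $$ (f i, l) else 0)"
        by (rule sum.cong) auto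
      finally show ?thesis using f(1)[OF ij(1)] by simp
    qed
    have "(P\<^sup>T * A * P) $$ (i, j) = (\<Sum>l = 0..<n. (P\<^sup>T * A) $$ (i, l) * (if l = f j then 1 else 0))"
      using ij A by (simp add: P_def scalar_prod_def)
    also have "\<dots> = (\<Sum>l = 0..<n. if l = f j then A $$ (f i, f j) else 0)"
      by (rule sum.cong) (auto simp: PA)
    also have "\<dots> = B $$ (i, j)" using f(1)[OF ij(2)] B(2)[OF ij] by simp
    finally show "B $$ (i, j) = (P\<^sup>T * A * P) $$ (i, j)" ..
  qed (use B in \<open>auto simp: P_def\<close>)
  then show ?thesis using A B d by (intro isometricI[of _ n _ P]) auto
qed

lemma orth_sum_carrier [simp, intro]:
  "A \<in> carrier_mat n m \<Longrightarrow> B \<in> carrier_mat n' m' \<Longrightarrow> orth_sum A B \<in> carrier_mat (n + n') (m + m')"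
  unfolding orth_sum_def by auto

lemma orth_sum_dim [simp]:
  "dim_row (orth_sum A B) = dim_row A + dim_row B" "dim_col (orth_sum A B) = dim_col A + dim_col B"
  unfolding orth_sum_def by auto

lemma orth_sum_index:
  "i < dim_row A + dim_row B \<Longrightarrow> j < dim_col A + dim_col B \<Longrightarrow> orth_sum A B $$ (i, j) =
    (if i < dim_row A then if j < dim_col A then A $$ (i, j) else 0
     else if j < dim_col A then 0 else B $$ (i - dim_row A, j - dim_col A))"
  unfolding orth_sum_def by auto

lemma orth_sum_assoc: "orth_sum (orth_sum A B) C = orth_sum A (orth_sum B C)"
  using assoc_four_block_mat[of A B C] unfolding orth_sum_def by simp

lemma orth_sum_empty [simp]:
  "orth_sum (0\<^sub>m 0 0) A = A" "orth_sum A (0\<^sub>m 0 0) = A"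
  by (auto intro!: eq_matI simp: orth_sum_index)

lemma orth_sum_mult:
  fixes A :: "'a::field mat"
  assumes "A \<in> carrier_mat n n" "B \<in> carrier_mat m m" "C \<in> carrier_mat n n" "D \<in> carrier_mat m m"
  shows "orth_sum A B * orth_sum C D = orth_sum (A * C) (B * D)"
  using assms unfolding orth_sum_def
  by (subst mult_four_block_mat[of _ n n _ m _ m _ _ n _ m]) auto

lemma orth_sum_transpose: "(orth_sum A B)\<^sup>T = orth_sum (A\<^sup>T) (B\<^sup>T)"
  by (rule eq_matI) (auto simp: orth_sum_index)

lemma orth_sum_det_nonzero:
  fixes A :: "'a::field mat"
  assumes A: "A \<in> carrier_mat n n" "det A \<noteq> 0" and B: "B \<in> carrier_mat m m" "det B \<noteq> 0"
  shows "det (orth_sum A B) \<noteq> 0"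
proof -
  from det_nonzero_inverse[OF A] obtain A' where A': "A' \<in> carrier_mat n n" "A * A' = 1\<^sub>m n" by blast
  from det_nonzero_inverse[OF B] obtain B' where B': "B' \<in> carrier_mat m m" "B * B' = 1\<^sub>m m" by blast
  have "orth_sum A B * orth_sum A' B' = 1\<^sub>m (n + m)"
    using orth_sum_mult[OF A(1) B(1) A'(1) B'(1)] A'(2) B'(2)
    by (simp add: orth_sum_def)
  then show ?thesis using A B A' B' by (intro inverse_det_nonzero[of _ "n + m" "orth_sum A' B'"]) auto
qed

lemma nonsingular_carrier: "nonsingular_form A \<Longrightarrow> A \<in> carrier_mat (dim_row A) (dim_row A)"
  by (auto simp: nonsingular_form_def)

lemma nonsingular_orth_sum:
  "nonsingular_form A \<Longrightarrow> nonsingular_form B \<Longrightarrow> nonsingular_form (orth_sum A B)"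
  using orth_sum_det_nonzero[OF nonsingular_carrier _ nonsingular_carrier, of A B]
  by (auto simp: nonsingular_form_def orth_sum_transpose)

lemma isometric_orth_sum:
  assumes "isometric A A'" "isometric B B'"
  shows "isometric (orth_sum A B) (orth_sum A' B')"
proof -
  from assms(1) obtain n P where c: "A \<in> carrier_mat n n" "A' \<in> carrier_mat n n" "P \<in> carrier_mat n n"
    and d: "det P \<noteq> 0" and A: "A = P\<^sup>T * A' * P" by (rule isometricE)
  from assms(2) obtain m Q where c': "B \<in> carrier_mat m m" "B' \<in> carrier_mat m m" "Q \<in> carrier_mat m m"
    and d': "det Q \<noteq> 0" and B: "B = Q\<^sup>T * B' * Q" by (rule isometricE)
  have "orth_sum A B = orth_sum (P\<^sup>T) (Q\<^sup>T) * orth_sum A' B' * orth_sum P Q"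
    using c c' by (simp add: orth_sum_mult[of _ n _ m] A B mult_square_carrier)
  then show ?thesis
    using c c' d d' by (intro isometricI[of _ "n + m" _ "orth_sum P Q"])
      (auto simp: orth_sum_transpose orth_sum_det_nonzero)
qed

lemma isometric_orth_sum_commute:
  fixes A B :: "'a::field mat"
  assumes "A \<in> carrier_mat n n" "B \<in> carrier_mat m m"
  shows "isometric (orth_sum A B) (orth_sum B A)"
proof (rule isometric_reindex[where n = "n + m" and f = "\<lambda>i. if i < n then i + m else i - n"])
  show "inj_on (\<lambda>i. if i < n then i + m else i - n) {..<n + m}"
  proof (rule inj_onI)
    fix i j assume "i \<in> {..<n + m}" "j \<in> {..<n + m}"
      and e: "(if i < n then i + m else i - n) = (if j < n then j + m else j - n)"
    then have ij: "i < n + m" "j < n + m" by auto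
    show "i = j" by (cases "i < n"; cases "j < n") (use e ij in simp_all)
  qed
  show "orth_sum A B $$ (i, j) = orth_sum B A $$ (if i < n then i + m else i - n, if j < n then j + m else j - n)"
    if "i < n + m" "j < n + m" for i j
    using that carrier_matD[OF assms(1)] carrier_matD[OF assms(2)]
    by (cases "i < n"; cases "j < n") (auto simp: orth_sum_index)
  show "orth_sum B A \<in> carrier_mat (n + m) (n + m)"
    using orth_sum_carrier[OF assms(2,1)] by (simp add: add.commute)
qed (use assms in auto)

lemma unary_form_carrier [simp]: "unary_form a \<in> carrier_mat 1 1"
  and unary_form_dim [simp]: "dim_row (unary_form a) = 1" "dim_col (unary_form a) = 1"
  and unary_form_index [simp]: "unary_form a $$ (0, 0) = a"
  by (auto simp: unary_form_def)

lemma nonsingular_unary: "a \<noteq> 0 \<Longrightarrow> nonsingular_form (unary_form a)"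
  by (auto simp: nonsingular_form_def unary_form_def det_single intro!: eq_matI)

lemma hyperbolic_plane_dim [simp]: "dim_row hyperbolic_plane = 2" "dim_col hyperbolic_plane = 2"
  by (auto simp: hyperbolic_plane_def)

lemma hyperbolic_form_dim [simp]:
  "dim_row (hyperbolic_form n) = 2 * n" "dim_col (hyperbolic_form n) = 2 * n"
  by (induction n) auto

lemma hyperbolic_form_carrier [simp, intro]: "hyperbolic_form n \<in> carrier_mat (2 * n) (2 * n)"
  by auto

lemma nonsingular_hyperbolic_plane: "nonsingular_form hyperbolic_plane"
  unfolding hyperbolic_plane_def by (intro nonsingular_orth_sum nonsingular_unary) auto

lemma nonsingular_empty: "nonsingular_form (0\<^sub>m 0 0)"
  by (auto simp: nonsingular_form_def)

lemma nonsingular_hyperbolic_form: "nonsingular_form (hyperbolic_form n)"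
  by (induction n) (auto intro: nonsingular_orth_sum nonsingular_hyperbolic_plane nonsingular_empty)

lemma hyperbolic_form_add:
  "orth_sum (hyperbolic_form m) (hyperbolic_form n) = hyperbolic_form (m + n)"
  by (induction m) (auto simp: orth_sum_assoc)

lemma tensor_form_dim [simp]:
  "dim_row (tensor_form A B) = dim_row A * dim_row B"
  "dim_col (tensor_form A B) = dim_col A * dim_col B"
  by (auto simp: tensor_form_def)

lemma tensor_form_carrier [simp, intro]:
  "A \<in> carrier_mat n m \<Longrightarrow> B \<in> carrier_mat n' m' \<Longrightarrow> tensor_form A B \<in> carrier_mat (n * n') (m * m')"
  by auto

lemma tensor_form_index:
  "i < dim_row A * dim_row B \<Longrightarrow> j < dim_col A * dim_col B \<Longrightarrow> tensor_form A B $$ (i, j) =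
    A $$ (i div dim_row B, j div dim_col B) * B $$ (i mod dim_row B, j mod dim_col B)"
  by (simp add: tensor_form_def)

lemma div_mod_less:
  fixes i m n :: nat
  assumes "i < m * n"
  shows "i div n < m" "i mod n < n"
proof -
  from assms have "0 < n" by (cases n) auto
  then show "i mod n < n" by simp
  from assms show "i div n < m" by (simp add: less_mult_imp_div_less)
qed

lemma sum_div_mod:
  fixes f :: "nat \<Rightarrow> 'a::semiring_0"
  shows "(\<Sum>k = 0..<m * n. f (k div n) * g (k mod n)) = (\<Sum>k = 0..<m. f k) * (\<Sum>k = 0..<n. g k)"
proof -
  have "(\<Sum>k = 0..<m * n. f (k div n) * g (k mod n)) = (\<Sum>k<m * n. f (k div n) * g (k mod n))"
    by (simp add: atLeast0LessThan)
  also have "\<dots> = (\<Sum>i<m. \<Sum>k = i * n..<i * n + n. f (k div n) * g (k mod n))"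
    by (rule sum.nat_group[symmetric])
  also have "\<dots> = (\<Sum>i<m. \<Sum>k = 0..<n. f i * g k)"
  proof (rule sum.cong[OF refl])
    fix i
    have "(\<Sum>k = i * n..<i * n + n. f (k div n) * g (k mod n))
       = (\<Sum>k = 0..<n. f ((k + i * n) div n) * g ((k + i * n) mod n))"
      using sum.shift_bounds_nat_ivl[of "\<lambda>k. f (k div n) * g (k mod n)" 0 "i * n" n]
      by (simp add: add.commute)
    also have "\<dots> = (\<Sum>k = 0..<n. f i * g k)"
      by (rule sum.cong) auto
    finally show "(\<Sum>k = i * n..<i * n + n. f (k div n) * g (k mod n)) = (\<Sum>k = 0..<n. f i * g k)" .
  qed
  finally show ?thesis by (simp add: sum_product atLeast0LessThan)
qed

lemma tensor_form_mult:
  fixes A :: "'a::field mat"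
  assumes "A \<in> carrier_mat n n" "B \<in> carrier_mat m m" "C \<in> carrier_mat n n" "D \<in> carrier_mat m m"
  shows "tensor_form A B * tensor_form C D = tensor_form (A * C) (B * D)"
proof (rule eq_matI)
  fix i j assume "i < dim_row (tensor_form (A * C) (B * D))" "j < dim_col (tensor_form (A * C) (B * D))"
  then have ij: "i < n * m" "j < n * m" using assms by auto
  note d = div_mod_less[OF ij(1)] div_mod_less[OF ij(2)]
  have "(tensor_form A B * tensor_form C D) $$ (i, j) =
      (\<Sum>k = 0..<n * m. tensor_form A B $$ (i, k) * tensor_form C D $$ (k, j))"
    using assms ij by (simp add: scalar_prod_def)
  also have "\<dots> = (\<Sum>k = 0..<n * m. (A $$ (i div m, k div m) * C $$ (k div m, j div m)) *
      (B $$ (i mod m, k mod m) * D $$ (k mod m, j mod m)))"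
    using assms ij by (intro sum.cong) (auto simp: tensor_form_index)
  also have "\<dots> = (\<Sum>k = 0..<n. A $$ (i div m, k) * C $$ (k, j div m)) *
      (\<Sum>k = 0..<m. B $$ (i mod m, k) * D $$ (k, j mod m))"
    by (rule sum_div_mod)
  also have "\<dots> = tensor_form (A * C) (B * D) $$ (i, j)"
    using assms ij d by (simp add: tensor_form_index scalar_prod_def)
  finally show "(tensor_form A B * tensor_form C D) $$ (i, j) = tensor_form (A * C) (B * D) $$ (i, j)" .
qed (use assms in auto)

lemma tensor_form_transpose: "(tensor_form A B)\<^sup>T = tensor_form (A\<^sup>T) (B\<^sup>T)"
  by (rule eq_matI) (auto simp: tensor_form_index div_mod_less)

lemma tensor_form_one: "tensor_form (1\<^sub>m n) (1\<^sub>m m) = (1\<^sub>m (n * m) :: 'a::field mat)"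
proof (rule eq_matI)
  fix i j assume "i < dim_row (1\<^sub>m (n * m) :: 'a mat)" "j < dim_col (1\<^sub>m (n * m) :: 'a mat)"
  then have ij: "i < n * m" "j < n * m" by auto
  have "i div m = j div m \<and> i mod m = j mod m \<longleftrightarrow> i = j" by (metis div_mult_mod_eq)
  then show "tensor_form (1\<^sub>m n) (1\<^sub>m m) $$ (i, j) = (1\<^sub>m (n * m) :: 'a mat) $$ (i, j)"
    using ij div_mod_less[OF ij(1)] div_mod_less[OF ij(2)] by (auto simp: tensor_form_index)
qed auto

lemma tensor_form_det_nonzero:
  fixes A :: "'a::field mat"
  assumes A: "A \<in> carrier_mat n n" "det A \<noteq> 0" and B: "B \<in> carrier_mat m m" "det B \<noteq> 0"
  shows "det (tensor_form A B) \<noteq> 0"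
proof -
  from det_nonzero_inverse[OF A] obtain A' where A': "A' \<in> carrier_mat n n" "A * A' = 1\<^sub>m n" by blast
  from det_nonzero_inverse[OF B] obtain B' where B': "B' \<in> carrier_mat m m" "B * B' = 1\<^sub>m m" by blast
  have "tensor_form A B * tensor_form A' B' = 1\<^sub>m (n * m)"
    using tensor_form_mult[OF A(1) B(1) A'(1) B'(1)] A'(2) B'(2) by (simp add: tensor_form_one)
  then show ?thesis using A B A' B' by (intro inverse_det_nonzero[of _ "n * m" "tensor_form A' B'"]) auto
qed

lemma nonsingular_tensor_form:
  "nonsingular_form A \<Longrightarrow> nonsingular_form B \<Longrightarrow> nonsingular_form (tensor_form A B)"
  using tensor_form_det_nonzero[OF nonsingular_carrier _ nonsingular_carrier, of A B]
  by (auto simp: nonsingular_form_def tensor_form_transpose)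

lemma isometric_tensor_form:
  assumes "isometric A A'" "isometric B B'"
  shows "isometric (tensor_form A B) (tensor_form A' B')"
proof -
  from assms(1) obtain n P where c: "A \<in> carrier_mat n n" "A' \<in> carrier_mat n n" "P \<in> carrier_mat n n"
    and d: "det P \<noteq> 0" and A: "A = P\<^sup>T * A' * P" by (rule isometricE)
  from assms(2) obtain m Q where c': "B \<in> carrier_mat m m" "B' \<in> carrier_mat m m" "Q \<in> carrier_mat m m"
    and d': "det Q \<noteq> 0" and B: "B = Q\<^sup>T * B' * Q" by (rule isometricE)
  have "tensor_form A B = tensor_form (P\<^sup>T) (Q\<^sup>T) * tensor_form A' B' * tensor_form P Q"
    using c c' by (simp add: tensor_form_mult[of _ n _ m] A B mult_square_carrier)
  then show ?thesis
    using c c' d d' by (intro isometricI[of _ "n * m" _ "tensor_form P Q"])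
      (auto simp: tensor_form_transpose tensor_form_det_nonzero)
qed

lemma isometric_tensor_form_commute:
  fixes A B :: "'a::field mat"
  assumes A: "A \<in> carrier_mat n n" and B: "B \<in> carrier_mat m m"
  shows "isometric (tensor_form A B) (tensor_form B A)"
proof (rule isometric_reindex[where n = "n * m" and f = "\<lambda>i. (i mod m) * n + i div m"])
  have less: "(i mod m) * n + i div m < n * m" if "i < n * m" for i
  proof -
    note d = div_mod_less[OF that]
    have "(i mod m) * n + i div m < (i mod m) * n + n" using d by simp
    also have "\<dots> = Suc (i mod m) * n" by simp
    also have "\<dots> \<le> m * n" using d(2) by (intro mult_le_mono1) simp
    finally show ?thesis by (simp add: mult.commute)
  qed
  then show "\<And>i. i < n * m \<Longrightarrow> (i mod m) * n + i div m < n * m" .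
  have dm: "((i mod m) * n + i div m) div n = i mod m" "((i mod m) * n + i div m) mod n = i div m"
    if "i < n * m" for i
    using div_mod_less[OF that] by auto
  show "inj_on (\<lambda>i. (i mod m) * n + i div m) {..<n * m}"
  proof (rule inj_onI)
    fix i j assume "i \<in> {..<n * m}" "j \<in> {..<n * m}"
      and e: "(i mod m) * n + i div m = (j mod m) * n + j div m"
    then have "i div m = j div m" "i mod m = j mod m" using dm[of i] dm[of j] by auto
    then show "i = j" by (metis div_mult_mod_eq)
  qed
  show "tensor_form A B $$ (i, j) =
      tensor_form B A $$ ((i mod m) * n + i div m, (j mod m) * n + j div m)"
    if "i < n * m" "j < n * m" for i j
    using A B that less[of i] less[of j] dm[of i] dm[of j]
    by (simp add: tensor_form_index mult.commute[of m n])
qed (use A B in \<open>auto simp: mult.commute\<close>)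

lemma tensor_form_assoc:
  fixes A :: "'a::field mat"
  shows "tensor_form (tensor_form A B) C = tensor_form A (tensor_form B C)"
proof (rule eq_matI)
  fix i j assume "i < dim_row (tensor_form A (tensor_form B C))" "j < dim_col (tensor_form A (tensor_form B C))"
  then have ij: "i < dim_row A * dim_row B * dim_row C" "j < dim_col A * dim_col B * dim_col C"
    by (auto simp: mult.assoc)
  have ij': "i < dim_row A * (dim_row B * dim_row C)" "j < dim_col A * (dim_col B * dim_col C)"
    using ij by (auto simp: mult.assoc)
  show "tensor_form (tensor_form A B) C $$ (i, j) = tensor_form A (tensor_form B C) $$ (i, j)"
    using ij ij' div_mod_less[OF ij(1)] div_mod_less[OF ij(2)] div_mod_less[OF ij'(1)] div_mod_less[OF ij'(2)]
    by (simp add: tensor_form_index div_mult2_eq mod_mult2_eq mult.commute[of "dim_row B"]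
        mult.commute[of "dim_col B"] mult.assoc)
qed (auto simp: mult.assoc)

lemma tensor_form_unary_one [simp]: "tensor_form (unary_form 1) A = (A :: 'a::field mat)"
  by (rule eq_matI) (auto simp: tensor_form_index)

lemma tensor_form_unary_minus_one:
  "tensor_form (unary_form (- 1)) A = - (A :: 'a::field mat)"
  by (rule eq_matI) (auto simp: tensor_form_index)

lemma tensor_form_empty [simp]: "tensor_form (0\<^sub>m 0 0) A = 0\<^sub>m 0 0"
  by (rule eq_matI) auto

lemma tensor_form_orth_sum:
  fixes A B C :: "'a::field mat"
  shows "tensor_form (orth_sum A B) C = orth_sum (tensor_form A C) (tensor_form B C)"
proof (rule eq_matI)
  fix i j
  assume "i < dim_row (orth_sum (tensor_form A C) (tensor_form B C))"
    "j < dim_col (orth_sum (tensor_form A C) (tensor_form B C))"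
  then have ij: "i < dim_row A * dim_row C + dim_row B * dim_row C"
    "j < dim_col A * dim_col C + dim_col B * dim_col C" by auto
  have ij': "i < (dim_row A + dim_row B) * dim_row C" "j < (dim_col A + dim_col B) * dim_col C"
    using ij by (auto simp: algebra_simps)
  note d = div_mod_less[OF ij'(1)] div_mod_less[OF ij'(2)]
  have split: "i div c < a \<longleftrightarrow> i < a * c" if "i mod c < c" for i a c :: nat
    using that by (intro div_less_iff_less_mult) auto
  have shift: "(i - a * c) div c = i div c - a" "(i - a * c) mod c = i mod c"
    if "\<not> i < a * c" for i a c :: nat
  proof -
    from that obtain t where "i = a * c + t" by (metis le_Suc_ex not_less)
    then show "(i - a * c) div c = i div c - a" "(i - a * c) mod c = i mod c"
      by (cases "c = 0"; simp)+
  qed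
  show "tensor_form (orth_sum A B) C $$ (i, j) = orth_sum (tensor_form A C) (tensor_form B C) $$ (i, j)"
    using ij ij' d split[OF d(2), of "dim_row A"] split[OF d(4), of "dim_col A"]
      shift[of i "dim_row A" "dim_row C"] shift[of j "dim_col A" "dim_col C"]
    by (auto simp: tensor_form_index orth_sum_index)
qed (auto simp: algebra_simps)

lemma uminus_nonsingular: "nonsingular_form A \<Longrightarrow> nonsingular_form (- A)"
  using nonsingular_tensor_form[OF nonsingular_unary[of "-1"], of A]
  by (simp add: tensor_form_unary_minus_one)

lemma orth_sum_uminus_isometric:
  fixes A :: "'a::field_char_neq_2 mat"
  assumes "nonsingular_form A" "dim_row A = n"
  shows "isometric (four_block_mat (0\<^sub>m n n) (1\<^sub>m n) (1\<^sub>m n) (0\<^sub>m n n)) (orth_sum A (- A))"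
proof -
  let ?h = "inverse 2 :: 'a"
  have A[simp]: "A \<in> carrier_mat n n" and sym: "A\<^sup>T = A" and d: "det A \<noteq> 0"
    using assms by (auto simp: nonsingular_form_def)
  from det_nonzero_inverse[OF A d] obtain B where B[simp]: "B \<in> carrier_mat n n"
    and AB: "A * B = 1\<^sub>m n" "B * A = 1\<^sub>m n" by blast
  have BT: "B\<^sup>T * A = 1\<^sub>m n"
    using transpose_mult[OF A B] AB(1) sym by simp
  have h: "?h * 2 = 1" "?h + ?h = 1"
    using two_neq_zero[where 'a='a] by (auto simp flip: mult_2)
  define U where "U = ?h \<cdot>\<^sub>m B"
  have U[simp]: "U \<in> carrier_mat n n" by (simp add: U_def)
  have AU: "A * U = ?h \<cdot>\<^sub>m 1\<^sub>m n" unfolding U_def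
    by (subst mult_smult_distrib[OF A B]) (simp add: AB)
  have UT: "U\<^sup>T = ?h \<cdot>\<^sub>m B\<^sup>T" by (rule eq_matI) (auto simp: U_def carrier_matD[OF B])
  have UA: "U\<^sup>T * A = ?h \<cdot>\<^sub>m 1\<^sub>m n" unfolding UT
    by (subst mult_smult_assoc_mat[of _ n n _ n]) (auto simp: BT)
  have hh: "?h \<cdot>\<^sub>m 1\<^sub>m n + ?h \<cdot>\<^sub>m 1\<^sub>m n = (1\<^sub>m n :: 'a mat)"
    by (rule eq_matI) (auto simp: two_neq_zero)
  define P where "P = four_block_mat (1\<^sub>m n) U (1\<^sub>m n) (- U)"
  let ?S = "orth_sum A (- A)"
  let ?T = "four_block_mat (0\<^sub>m n n) (1\<^sub>m n) (1\<^sub>m n) (0\<^sub>m n n) :: 'a mat"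
  have uT: "(- U)\<^sup>T = - (U\<^sup>T)" by (rule eq_matI) auto
  have PT: "P\<^sup>T = four_block_mat (1\<^sub>m n) (1\<^sub>m n) (U\<^sup>T) (- (U\<^sup>T))"
    unfolding P_def by (subst transpose_four_block_mat[of _ n n _ n _ n]) (auto simp: uT)
  have c[simp]: "P \<in> carrier_mat (n + n) (n + n)" "?S \<in> carrier_mat (n + n) (n + n)"
    unfolding P_def by auto
  have UAm: "- (U\<^sup>T) * - A = U\<^sup>T * A"
    by (subst uminus_mult_left_mat, use carrier_matD[OF A] carrier_matD[OF U] in simp)
      (subst uminus_mult_right_mat, use carrier_matD[OF A] carrier_matD[OF U] in auto)
  have PTS: "P\<^sup>T * ?S = four_block_mat A (- A) (?h \<cdot>\<^sub>m 1\<^sub>m n) (?h \<cdot>\<^sub>m 1\<^sub>m n)"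
    unfolding PT orth_sum_def
    by (subst mult_four_block_mat[of _ n n _ n _ n _ _ n _ n]) (auto simp: UA UAm carrier_matD[OF A] right_mult_zero_mat[of _ n n])
  have 1: "- A * - U = ?h \<cdot>\<^sub>m 1\<^sub>m n"
    by (subst uminus_mult_left_mat, use carrier_matD[OF A] carrier_matD[OF U] in simp)
      (subst uminus_mult_right_mat, use carrier_matD[OF A] carrier_matD[OF U] in \<open>auto simp: AU\<close>)
  have 2: "A + - A = 0\<^sub>m n n" by (rule eq_matI) (auto simp: carrier_matD[OF A])
  have 3: "?h \<cdot>\<^sub>m 1\<^sub>m n * U + ?h \<cdot>\<^sub>m 1\<^sub>m n * - U = 0\<^sub>m n n"
    by (simp add: mult_smult_assoc_mat[of _ n n _ n]) (auto intro!: eq_matI simp: carrier_matD[OF U])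
  have m1: "M * 1\<^sub>m n = M" if "M \<in> carrier_mat n n" for M :: "'a mat"
    by (rule right_mult_one_mat[OF that])
  have 4: "A * 1\<^sub>m n + - A * 1\<^sub>m n = 0\<^sub>m n n"
    by (subst (1 2) m1) (use 2 in simp_all)
  have 5: "A * U + - A * - U = 1\<^sub>m n" unfolding AU 1 hh ..
  have 6: "?h \<cdot>\<^sub>m 1\<^sub>m n * 1\<^sub>m n + ?h \<cdot>\<^sub>m 1\<^sub>m n * 1\<^sub>m n = (1\<^sub>m n :: 'a mat)"
    by (subst (1 2) m1) (use hh in simp_all)
  have "P\<^sup>T * ?S * P = four_block_mat
      (A * 1\<^sub>m n + - A * 1\<^sub>m n) (A * U + - A * - U)
      (?h \<cdot>\<^sub>m 1\<^sub>m n * 1\<^sub>m n + ?h \<cdot>\<^sub>m 1\<^sub>m n * 1\<^sub>m n) (?h \<cdot>\<^sub>m 1\<^sub>m n * U + ?h \<cdot>\<^sub>m 1\<^sub>m n * - U)"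
    unfolding PTS unfolding P_def
    by (rule mult_four_block_mat[of _ n n _ n _ n _ _ n _ n]) simp_all
  then have "P\<^sup>T * ?S * P = ?T" unfolding 3 4 5 6 .
  moreover have "det P \<noteq> 0"
  proof -
    have "?T * ?T = 1\<^sub>m (n + n)"
      by (subst mult_four_block_mat[of _ n n _ n _ n _ _ n _ n]) simp_all
    then have "det ?T \<noteq> 0"
      by (intro inverse_det_nonzero[of _ "n + n" ?T]) simp_all
    then have "det (P\<^sup>T * ?S * P) \<noteq> 0" using calculation by simp
    moreover have "det (P\<^sup>T * ?S * P) = det (P\<^sup>T * ?S) * det P"
      by (rule det_mult[of _ "n + n"]) (auto simp: mult_square_carrier)
    ultimately show ?thesis by auto
  qed
  ultimately show ?thesis by (intro isometricI[of _ "n + n" _ P]) auto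
qed

lemma tensor_hyperbolic_plane: "tensor_form hyperbolic_plane A = orth_sum A (- A)"
  by (simp add: hyperbolic_plane_def tensor_form_orth_sum tensor_form_unary_minus_one)

lemma nonsingular_one: "nonsingular_form (1\<^sub>m n)"
  by (simp add: nonsingular_form_def)

lemma tensor_one_hyperbolic_plane: "tensor_form (1\<^sub>m n) hyperbolic_plane = hyperbolic_form n"
proof (induction n)
  case 0
  have "(1\<^sub>m 0 :: 'a mat) = 0\<^sub>m 0 0" by (rule eq_matI) auto
  then show ?case by simp
next
  case (Suc n)
  have "(1\<^sub>m (Suc n) :: 'a mat) = orth_sum (unary_form 1) (1\<^sub>m n)"
    by (rule eq_matI) (auto simp: orth_sum_index)
  then show ?case using Suc by (simp add: tensor_form_orth_sum)
qed

lemma orth_sum_uminus_hyperbolic: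
  fixes A :: "'a::field_char_neq_2 mat"
  assumes "nonsingular_form A" "dim_row A = n"
  shows "isometric (orth_sum A (- A)) (hyperbolic_form n)"
proof -
  have "isometric (orth_sum A (- A)) (four_block_mat (0\<^sub>m n n) (1\<^sub>m n) (1\<^sub>m n) (0\<^sub>m n n))"
    by (rule isometric_sym[OF orth_sum_uminus_isometric[OF assms]])
  also have "isometric \<dots> (orth_sum (1\<^sub>m n) (- 1\<^sub>m n))"
    by (rule orth_sum_uminus_isometric[OF nonsingular_one]) simp
  also have "orth_sum (1\<^sub>m n) (- 1\<^sub>m n :: 'a mat) = tensor_form hyperbolic_plane (1\<^sub>m n)"
    by (simp add: tensor_hyperbolic_plane)
  also have "isometric (tensor_form hyperbolic_plane (1\<^sub>m n)) (tensor_form (1\<^sub>m n) (hyperbolic_plane :: 'a mat))"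
    by (rule isometric_tensor_form_commute[of _ 2 _ n]) auto
  finally show ?thesis by (simp add: tensor_one_hyperbolic_plane)
qed

lemma tensor_hyperbolic_form:
  fixes A :: "'a::field_char_neq_2 mat"
  assumes "nonsingular_form A"
  shows "isometric (tensor_form (hyperbolic_form m) A) (hyperbolic_form (m * dim_row A))"
proof (induction m)
  case 0
  show ?case by (simp add: isometric_refl[of _ 0])
next
  case (Suc m)
  have "isometric (tensor_form (hyperbolic_form (Suc m)) A)
     (orth_sum (hyperbolic_form (dim_row A)) (hyperbolic_form (m * dim_row A)))"
    using isometric_orth_sum[OF orth_sum_uminus_hyperbolic[OF assms refl] Suc]
    by (simp add: tensor_form_orth_sum tensor_hyperbolic_plane)
  then show ?case by (simp add: hyperbolic_form_add)
qed

lemma isometric_imp_witt_equiv: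
  assumes "nonsingular_form A" "nonsingular_form B" "isometric A B"
  shows "witt_equiv A B"
  unfolding witt_equiv_def using assms by (auto intro!: exI[of _ 0])

lemma witt_equiv_refl: "nonsingular_form A \<Longrightarrow> witt_equiv A A"
  by (meson isometric_imp_witt_equiv isometric_refl nonsingular_carrier)

lemma witt_equiv_sym: "witt_equiv A B \<Longrightarrow> witt_equiv B A"
  unfolding witt_equiv_def using isometric_sym by blast

lemma witt_equiv_trans:
  assumes "witt_equiv A B" "witt_equiv B C"
  shows "witt_equiv A C"
proof -
  let ?H = hyperbolic_form
  from assms obtain m n m' n' where
    1: "isometric (orth_sum A (?H m)) (orth_sum B (?H n))" and
    2: "isometric (orth_sum B (?H m')) (orth_sum C (?H n'))" and
    ns: "nonsingular_form A" "nonsingular_form B" "nonsingular_form C"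
    unfolding witt_equiv_def by blast
  have r: "isometric (?H k) (?H k)" for k by (rule isometric_refl) auto
  have "isometric (orth_sum A (?H (m + m'))) (orth_sum B (?H (n + m')))"
    using isometric_orth_sum[OF 1 r[of m']] by (simp add: orth_sum_assoc hyperbolic_form_add)
  also have "isometric (orth_sum B (?H (n + m'))) (orth_sum C (?H (n + n')))"
    using isometric_orth_sum[OF 2 r[of n]]
    by (simp add: orth_sum_assoc hyperbolic_form_add add.commute)
  finally show ?thesis unfolding witt_equiv_def using ns by blast
qed

lemma witt_equiv_orth_sum_right:
  assumes "witt_equiv A A'" "nonsingular_form B"
  shows "witt_equiv (orth_sum B A) (orth_sum B A')"
proof -
  from assms obtain m n where
    1: "isometric (orth_sum A (hyperbolic_form m)) (orth_sum A' (hyperbolic_form n))" and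
    ns: "nonsingular_form A" "nonsingular_form A'"
    unfolding witt_equiv_def by blast
  have "isometric B B" using assms(2) by (meson isometric_refl nonsingular_carrier)
  from isometric_orth_sum[OF this 1] show ?thesis
    unfolding witt_equiv_def using ns assms(2)
    by (auto simp: orth_sum_assoc intro: nonsingular_orth_sum)
qed

lemma witt_equiv_orth_sum_commute:
  assumes "nonsingular_form A" "nonsingular_form B"
  shows "witt_equiv (orth_sum A B) (orth_sum B A)"
  using assms isometric_orth_sum_commute[OF nonsingular_carrier nonsingular_carrier, of A B]
  by (intro isometric_imp_witt_equiv nonsingular_orth_sum) auto

lemma witt_equiv_orth_sum:
  assumes "witt_equiv A A'" "witt_equiv B B'"
  shows "witt_equiv (orth_sum A B) (orth_sum A' B')"
proof -
  have ns: "nonsingular_form A" "nonsingular_form A'" "nonsingular_form B" "nonsingular_form B'"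
    using assms by (auto simp: witt_equiv_def)
  show ?thesis
    by (rule witt_equiv_trans[OF witt_equiv_orth_sum_right[OF assms(2) ns(1)]],
        rule witt_equiv_trans[OF witt_equiv_orth_sum_commute[OF ns(1) ns(4)]],
        rule witt_equiv_trans[OF witt_equiv_orth_sum_right[OF assms(1) ns(4)]],
        rule witt_equiv_orth_sum_commute[OF ns(4) ns(2)])
qed

lemma witt_equiv_tensor_left:
  fixes A :: "'a::field_char_neq_2 mat"
  assumes "witt_equiv A A'" "nonsingular_form B"
  shows "witt_equiv (tensor_form A B) (tensor_form A' B)"
proof -
  let ?H = "hyperbolic_form :: nat \<Rightarrow> 'a mat"
  from assms obtain m n where
    1: "isometric (orth_sum A (?H m)) (orth_sum A' (?H n))" and
    ns: "nonsingular_form A" "nonsingular_form A'"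
    unfolding witt_equiv_def by blast
  have r: "isometric C C" if "nonsingular_form C" for C :: "'a mat"
    using that by (meson isometric_refl nonsingular_carrier)
  note t = nonsingular_tensor_form[OF _ assms(2)]
  have s: "isometric (orth_sum (tensor_form C B) (tensor_form (?H k) B))
      (orth_sum (tensor_form C B) (?H (k * dim_row B)))" if "nonsingular_form C" for C k
    by (intro isometric_orth_sum r t that tensor_hyperbolic_form assms)
  have "isometric (orth_sum (tensor_form A B) (tensor_form (?H m) B))
      (orth_sum (tensor_form A' B) (tensor_form (?H n) B))"
    using isometric_tensor_form[OF 1 r[OF assms(2)]] by (simp add: tensor_form_orth_sum)
  then have "isometric (orth_sum (tensor_form A B) (?H (m * dim_row B)))
      (orth_sum (tensor_form A' B) (?H (n * dim_row B)))"
    by (rule isometric_trans[OF isometric_trans[OF isometric_sym[OF s[OF ns(1)]] _] s[OF ns(2)]])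
  then show ?thesis unfolding witt_equiv_def using t ns by blast
qed

lemma witt_equiv_tensor_commute:
  assumes "nonsingular_form A" "nonsingular_form B"
  shows "witt_equiv (tensor_form A B) (tensor_form B A)"
  using assms isometric_tensor_form_commute[OF nonsingular_carrier nonsingular_carrier, of A B]
  by (intro isometric_imp_witt_equiv nonsingular_tensor_form) auto

lemma witt_equiv_tensor:
  fixes A :: "'a::field_char_neq_2 mat"
  assumes "witt_equiv A A'" "witt_equiv B B'"
  shows "witt_equiv (tensor_form A B) (tensor_form A' B')"
proof -
  have ns: "nonsingular_form A" "nonsingular_form A'" "nonsingular_form B" "nonsingular_form B'"
    using assms by (auto simp: witt_equiv_def)
  show ?thesis
    by (rule witt_equiv_trans[OF witt_equiv_tensor_left[OF assms(1) ns(3)]],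
        rule witt_equiv_trans[OF witt_equiv_tensor_commute[OF ns(2) ns(3)]],
        rule witt_equiv_trans[OF witt_equiv_tensor_left[OF assms(2) ns(2)]],
        rule witt_equiv_tensor_commute[OF ns(4) ns(2)])
qed

lemma witt_equiv_orth_sum_uminus:
  fixes A :: "'a::field_char_neq_2 mat"
  assumes "nonsingular_form A"
  shows "witt_equiv (orth_sum (- A) A) (0\<^sub>m 0 0)"
proof -
  have "isometric (orth_sum (orth_sum A (- A)) (hyperbolic_form 0))
      (orth_sum (0\<^sub>m 0 0) (hyperbolic_form (dim_row A)))"
    using orth_sum_uminus_hyperbolic[OF assms refl] by simp
  then have "witt_equiv (orth_sum A (- A)) (0\<^sub>m 0 0)"
    unfolding witt_equiv_def
    using nonsingular_orth_sum[OF assms uminus_nonsingular[OF assms]] nonsingular_empty by blast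
  then show ?thesis
    by (rule witt_equiv_trans[OF witt_equiv_orth_sum_commute[OF uminus_nonsingular[OF assms] assms]])
qed

lemma witt_equiv_uminus:
  fixes A :: "'a::field_char_neq_2 mat"
  assumes "witt_equiv A B"
  shows "witt_equiv (- A) (- B)"
  using witt_equiv_tensor[OF witt_equiv_refl[OF nonsingular_unary[of "-1"]] assms]
  by (simp add: tensor_form_unary_minus_one)

lemma witt_equiv_even_dim:
  assumes "witt_equiv A B"
  shows "even (dim_row A) \<longleftrightarrow> even (dim_row B)"
proof -
  from assms obtain m n where "isometric (orth_sum A (hyperbolic_form m)) (orth_sum B (hyperbolic_form n))"
    unfolding witt_equiv_def by blast
  from isometric_dim[OF this] have "dim_row A + 2 * m = dim_row B + 2 * n" by simp
  then show ?thesis by presburger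
qed

quotient_type (overloaded) 'a witt = "'a::field_char_neq_2 mat" / partial: witt_equiv
  morphisms rep_witt witt_class
proof (rule part_equivpI)
  show "\<exists>A :: 'a mat. witt_equiv A A" using witt_equiv_refl nonsingular_empty by blast
  show "symp (witt_equiv :: 'a mat \<Rightarrow> _)" by (auto intro: sympI witt_equiv_sym)
  show "transp (witt_equiv :: 'a mat \<Rightarrow> _)" by (auto intro: transpI witt_equiv_trans)
qed

instantiation witt :: (field_char_neq_2) comm_ring_1
begin

lift_definition zero_witt :: "'a witt" is "0\<^sub>m 0 0"
  by (rule witt_equiv_refl[OF nonsingular_empty])

lift_definition one_witt :: "'a witt" is "unary_form 1"
  by (rule witt_equiv_refl[OF nonsingular_unary]) simp

lift_definition plus_witt :: "'a witt \<Rightarrow> 'a witt \<Rightarrow> 'a witt" is orth_sum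
  by (rule witt_equiv_orth_sum)

lift_definition times_witt :: "'a witt \<Rightarrow> 'a witt \<Rightarrow> 'a witt" is tensor_form
  by (rule witt_equiv_tensor)

lift_definition uminus_witt :: "'a witt \<Rightarrow> 'a witt" is uminus
  by (rule witt_equiv_uminus)

definition minus_witt :: "'a witt \<Rightarrow> 'a witt \<Rightarrow> 'a witt" where
  "minus_witt x y = x + - y"

instance
proof
  fix a b c :: "'a witt"
  have ns: "nonsingular_form A" if "witt_equiv A A" for A :: "'a mat"
    using that by (simp add: witt_equiv_def)
  note r = witt_equiv_refl and no = nonsingular_orth_sum and nt = nonsingular_tensor_form
  show "a + b + c = a + (b + c)"
    by transfer (auto simp: orth_sum_assoc intro!: r no dest!: ns)
  show "a + b = b + a" by transfer (auto intro!: witt_equiv_orth_sum_commute dest!: ns)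
  show "0 + a = a" by transfer simp
  show "- a + a = 0" by transfer (auto intro!: witt_equiv_orth_sum_uminus dest!: ns)
  show "a - b = a + - b" by (rule minus_witt_def)
  show "a * b * c = a * (b * c)"
    by transfer (auto simp: tensor_form_assoc intro!: r nt dest!: ns)
  show "a * b = b * a" by transfer (auto intro!: witt_equiv_tensor_commute dest!: ns)
  show "1 * a = a" by transfer simp
  show "(a + b) * c = a * c + b * c"
    by transfer (auto simp: tensor_form_orth_sum intro!: r no nt dest!: ns)
  show "(0 :: 'a witt) \<noteq> 1" by transfer (auto dest!: witt_equiv_even_dim)
qed

end

definition ring_ideal :: "'a::comm_ring_1 set \<Rightarrow> bool" where
  "ring_ideal I \<longleftrightarrow> 0 \<in> I \<and> (\<forall>x\<in>I. \<forall>y\<in>I. x + y \<in> I) \<and> (\<forall>c. \<forall>x\<in>I. c * x \<in> I)"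

definition ideal_gen :: "'a::comm_ring_1 set \<Rightarrow> 'a set" where
  "ideal_gen S = ring_ideal hull S"

fun ideal_pow :: "'a::comm_ring_1 set \<Rightarrow> nat \<Rightarrow> 'a set" where
  "ideal_pow I 0 = UNIV"
| "ideal_pow I (Suc n) = ideal_gen {x * y | x y. x \<in> I \<and> y \<in> ideal_pow I n}"

definition witt_torsion :: "'a::field_char_neq_2 itself \<Rightarrow> 'a witt set" where
  "witt_torsion F = {x. \<exists>n>0. of_nat n * x = 0}"

definition fundamental_ideal :: "'a::field_char_neq_2 itself \<Rightarrow> 'a witt set" where
  "fundamental_ideal F = {witt_class A | A. nonsingular_form A \<and> even (dim_row A)}"

definition torsion_fundamental_ideal :: "'a::field_char_neq_2 itself \<Rightarrow> 'a witt set" where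
  "torsion_fundamental_ideal F = fundamental_ideal F \<inter> witt_torsion F"

definition eval_int_poly :: "int poly \<Rightarrow> 'b::comm_ring_1 \<Rightarrow> 'b" where
  "eval_int_poly f x = poly (map_poly of_int f) x"

definition torsion_annihilator :: "'a::field_char_neq_2 itself \<Rightarrow> int poly set" where
  "torsion_annihilator F = {f. \<forall>\<phi>\<in>torsion_fundamental_ideal F. eval_int_poly f \<phi> = 0}"

definition torsion_annihilator' :: "'a::field_char_neq_2 itself \<Rightarrow> int poly set" where
  "torsion_annihilator' F = torsion_annihilator F \<inter> {[:0, 1:] * g | g. True}"

text \<open>
  Here \<open>k\<close> is the index with \<open>\<nu>\<^sub>2((2k-2)!) < r \<le> \<nu>\<^sub>2((2k)!)\<close>, so all exponents
  \<open>r - \<nu>\<^sub>2((2i)!)\<close> occurring below are positive and no truncation takes place.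
\<close>

definition J'_e :: "nat \<Rightarrow> nat \<Rightarrow> int poly set" where
  "J'_e r k = ideal_gen ({monom (2 ^ r) 1}
     \<union> {monom (2 ^ (r - multiplicity 2 (fact (2 * i) :: nat))) (2 * i) | i. 1 \<le> i \<and> i \<le> k - 1}
     \<union> {monom 1 (2 * k)})"

lemma ring_ideal_ideal_gen: "ring_ideal (ideal_gen S)"
  unfolding ideal_gen_def by (rule hull_in) (auto simp: ring_ideal_def)

lemma eval_int_poly_altdef:
  "eval_int_poly f x = (\<Sum>i\<le>degree f. of_int (coeff f i) * x ^ i)"
proof -
  have "degree (map_poly of_int f :: 'a poly) \<le> degree f" by (simp add: degree_le coeff_map_poly coeff_eq_0)
  then have "eval_int_poly f x = (\<Sum>i\<le>degree f. coeff (map_poly of_int f) i * x ^ i)"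
    unfolding eval_int_poly_def poly_altdef
    by (intro sum.mono_neutral_left) (auto simp: coeff_eq_0)
  then show ?thesis by (simp add: coeff_map_poly)
qed

lemma ring_ideal_fundamental_ideal:
  "ring_ideal (fundamental_ideal TYPE('a::field_char_neq_2))"
proof -
  let ?I = "fundamental_ideal TYPE('a)"
  have rep: "\<exists>A. nonsingular_form A \<and> x = witt_class A" for x :: "'a witt"
    by (metis Quotient3_abs_rep Quotient3_rep_reflp Quotient3_witt witt_equiv_def)
  have plus: "witt_class A + witt_class B = witt_class (orth_sum A B)"
    and times: "witt_class A * witt_class B = witt_class (tensor_form A B)"
    if "nonsingular_form A" "nonsingular_form B" for A B :: "'a mat"
    using that by (simp_all add: plus_witt.abs_eq times_witt.abs_eq witt_equiv_refl)
  have "0 \<in> ?I" unfolding fundamental_ideal_def zero_witt.abs_eq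
    using nonsingular_empty by (intro CollectI exI[of _ "0\<^sub>m 0 0"]) auto
  moreover have "x + y \<in> ?I" if "x \<in> ?I" "y \<in> ?I" for x y
  proof -
    from that obtain A B where AB: "nonsingular_form A" "even (dim_row A)" "x = witt_class A"
      "nonsingular_form B" "even (dim_row B)" "y = witt_class B"
      unfolding fundamental_ideal_def by blast
    then show ?thesis unfolding fundamental_ideal_def
      by (intro CollectI exI[of _ "orth_sum A B"]) (auto simp: plus nonsingular_orth_sum)
  qed
  moreover have "c * x \<in> ?I" if "x \<in> ?I" for c x
  proof -
    from that obtain A where A: "nonsingular_form A" "even (dim_row A)" "x = witt_class A"
      unfolding fundamental_ideal_def by blast
    from rep[of c] obtain C where C: "nonsingular_form C" "c = witt_class C" by blast
    show ?thesis unfolding fundamental_ideal_def using A C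
      by (intro CollectI exI[of _ "tensor_form C A"]) (auto simp: times nonsingular_tensor_form)
  qed
  ultimately show ?thesis unfolding ring_ideal_def by blast
qed

lemma ring_ideal_torsion_fundamental_ideal:
  "ring_ideal (torsion_fundamental_ideal TYPE('a::field_char_neq_2))"
proof -
  have "ring_ideal (witt_torsion TYPE('a))"
    unfolding ring_ideal_def
  proof (intro conjI ballI allI)
    show "0 \<in> witt_torsion TYPE('a)" by (auto simp: witt_torsion_def)
  next
    fix x y assume "x \<in> witt_torsion TYPE('a)" "y \<in> witt_torsion TYPE('a)"
    then obtain m n where mn: "m > 0" "of_nat m * x = 0" "n > 0" "of_nat n * y = 0"
      unfolding witt_torsion_def by blast
    have "of_nat (m * n) * (x + y) = of_nat n * (of_nat m * x) + of_nat m * (of_nat n * y)"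
      by (simp add: algebra_simps)
    also have "\<dots> = 0" by (simp add: mn)
    finally show "x + y \<in> witt_torsion TYPE('a)"
      unfolding witt_torsion_def using mn by (intro CollectI exI[of _ "m * n"]) auto
  next
    fix c x assume "x \<in> witt_torsion TYPE('a)"
    then obtain n where n: "n > 0" "of_nat n * x = 0" unfolding witt_torsion_def by blast
    then show "c * x \<in> witt_torsion TYPE('a)"
      unfolding witt_torsion_def by (intro CollectI exI[of _ n]) (simp add: mult.left_commute)
  qed
  then show ?thesis
    using ring_ideal_fundamental_ideal unfolding torsion_fundamental_ideal_def ring_ideal_def by blast
qed

text \<open>The truncated subtraction is harmless: \<open>k = 0\<close> never qualifies when \<open>r \<ge> 1\<close>.\<close>

lemma ex1_bracketing_index:
  fixes r :: nat
  assumes "r \<ge> 1"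
  shows "\<exists>!k. multiplicity 2 (fact (2 * k - 2) :: nat) < r \<and> r \<le> multiplicity 2 (fact (2 * k) :: nat)"
proof -
  define f where "f k = multiplicity 2 (fact (2 * k) :: nat)" for k
  have f0: "f 0 = 0" by (simp add: f_def)
  have step: "f k < f (Suc k)" for k
  proof -
    have "(fact (2 * Suc k) :: nat) = 2 * (Suc k * (2 * k + 1)) * fact (2 * k)"
      by (simp add: algebra_simps)
    then have "f (Suc k) = multiplicity 2 (2 * (Suc k * (2 * k + 1))) + f k"
      unfolding f_def by (simp only:) (subst prime_elem_multiplicity_mult_distrib, auto)
    moreover have "multiplicity 2 (2 * (Suc k * (2 * k + 1))) > 0"
      by (rule multiplicity_gt_zero_iff[THEN iffD2]) auto
    ultimately show ?thesis by simp
  qed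
  have mono: "f i \<le> f j" if "i \<le> j" for i j
    using lift_Suc_mono_le[of f, OF less_imp_le[OF step] that] .
  have large: "k \<le> f k" for k
    by (induction k) (use step in \<open>auto simp: Suc_le_eq intro: le_less_trans\<close>)
  have fm: "multiplicity 2 (fact (2 * k - 2) :: nat) = f (k - 1)" for k
    by (simp add: f_def diff_mult_distrib2)
  show ?thesis unfolding fm f_def[symmetric]
  proof (rule ex_ex1I)
    define k where "k = (LEAST k. r \<le> f k)"
    have k: "r \<le> f k" unfolding k_def by (rule LeastI[of _ r]) (rule large)
    then have "k \<noteq> 0" using f0 assms by (cases "k = 0") auto
    then have "\<not> r \<le> f (k - 1)" using not_less_Least[of "k - 1" "\<lambda>k. r \<le> f k"] by (simp add: k_def)
    then show "\<exists>k. f (k - 1) < r \<and> r \<le> f k" using k by (intro exI[of _ k]) auto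
  next
    fix k l assume kl: "f (k - 1) < r \<and> r \<le> f k" "f (l - 1) < r \<and> r \<le> f l"
    show "k = l"
    proof (rule ccontr)
      assume "k \<noteq> l"
      then have "k \<le> l - 1 \<or> l \<le> k - 1" by arith
      then show False using kl mono[of k "l - 1"] mono[of l "k - 1"] by auto
    qed
  qed
qed

end

theory Submission
  imports Defs
begin

text \<open>
  A form in \<open>I(F)\<close> is a sum of binary forms \<open>x + y\<close> with \<open>x\<^sup>2 = y\<^sup>2 = 1\<close>, whose \<open>n\<close>-th powers are
  divisible by \<open>2\<^sup>n\<^sup>-\<^sup>1\<close>; by the binomial theorem the \<open>n\<close>-th power of any element of \<open>I(F)\<close> is
  \<open>2\<close> to the power \<open>\<nu>\<^sub>2(n!)\<close> times some \<open>\<psi>\<close>.  If the element is torsion then so is \<open>\<psi>\<close>, hence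
  \<open>2\<^sup>r \<psi> = 0\<close>, and the generators of the ideal annihilate \<open>I\<^sub>t(F)\<close>.  Conversely, the \<open>n\<close>-th finite
  difference of an annihilating polynomial of degree \<open>n < 2k\<close> with leading coefficient \<open>c\<close> gives
  \<open>n! c x\<^sub>1 \<cdots> x\<^sub>n = 0\<close> for all \<open>x\<^sub>i\<close> in \<open>I\<^sub>t(F)\<close>.  Some such product has additive order exactly \<open>2\<^sup>r\<close>,
  so \<open>2\<^sup>r\<close> divides \<open>n! c\<close> and the leading term lies in the ideal; induct on the degree.
\<close>

section \<open>Evaluation, finite differences and products in ideal powers\<close>

lemma eval_int_poly_simps:
  fixes x :: "'b::comm_ring_1"
  shows "eval_int_poly (f + g) x = eval_int_poly f x + eval_int_poly g x"
    and "eval_int_poly (f - g) x = eval_int_poly f x - eval_int_poly g x"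
    and "eval_int_poly (f * g) x = eval_int_poly f x * eval_int_poly g x"
    and "eval_int_poly (monom c n) x = of_int c * x ^ n"
    and "eval_int_poly 0 x = 0"
proof -
  have "map_poly of_int (f + g) = map_poly of_int f + (map_poly of_int g :: 'b poly)"
    "map_poly of_int (f - g) = map_poly of_int f - (map_poly of_int g :: 'b poly)"
    "map_poly of_int (f * g) = map_poly of_int f * (map_poly of_int g :: 'b poly)"
    by (auto intro!: poly_eqI simp: coeff_map_poly coeff_mult)
  then show "eval_int_poly (f + g) x = eval_int_poly f x + eval_int_poly g x"
    "eval_int_poly (f - g) x = eval_int_poly f x - eval_int_poly g x"
    "eval_int_poly (f * g) x = eval_int_poly f x * eval_int_poly g x"
    by (simp_all add: eval_int_poly_def)
  show "eval_int_poly (monom c n) x = of_int c * x ^ n" "eval_int_poly 0 x = 0"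
    by (simp_all add: eval_int_poly_def map_poly_monom poly_monom)
qed

text \<open>One finite difference of p with step x. The ring may have zero divisors, so the claim is
  a degree bound with a coefficient at a fixed position, not an exact degree with a leading
  coefficient.\<close>

lemma coeff_pcompose_shift_diff:
  fixes p :: "'b::comm_ring_1 poly"
  assumes "degree p \<le> Suc n"
  shows "degree (pcompose p [:x, 1:] - p) \<le> n
    \<and> coeff (pcompose p [:x, 1:] - p) n = of_nat (Suc n) * x * coeff p (Suc n)"
  using assms
proof (induction p arbitrary: n)
  case 0
  then show ?case by simp
next
  case (pCons a p)
  define D where "D = pcompose p [:x, 1:] - p"
  \<comment> \<open>Substitute p(X + x) = p + D into (X + x) p(X + x) - X p; the constant a
    cancels.\<close>
  have step: "pcompose (pCons a p) [:x, 1:] - pCons a p = smult x p + smult x D + pCons 0 D"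
    by (rule poly_eqI) (auto simp: D_def pcompose_pCons algebra_simps coeff_pCons split: nat.splits)
  have p: "degree p \<le> n" using pCons.prems pCons.hyps by (auto split: if_splits)
  show ?case
  proof (cases n)
    case 0
    then obtain b where "p = [:b:]" using p by (auto elim: degree_eq_zeroE)
    then show ?thesis using 0 by (simp add: pcompose_pCons)
  next
    case (Suc m)
    then have D: "degree D \<le> m" "coeff D m = of_nat (Suc m) * x * coeff p (Suc m)"
      using pCons.IH[of m] p by (auto simp: D_def)
    have "degree (smult x p + smult x D + pCons 0 D) \<le> n"
      using D(1) p Suc by (intro degree_add_le) (auto intro: order.trans[OF degree_smult_le])
    moreover have "coeff D (Suc m) = 0" using D(1) by (simp add: coeff_eq_0)
    ultimately show ?thesis unfolding step using D(2) Suc by (simp add: algebra_simps)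
  qed
qed

text \<open>Since \<open>I\<close> is closed under addition, differencing with step x in
  \<open>I\<close> preserves vanishing on \<open>I\<close>. Each entry of \<open>xs\<close> lowers
  the degree bound by one and contributes its factor to the product and one factor of the
  factorial.\<close>

lemma polarization_annihilates:
  fixes p :: "'b::comm_ring_1 poly"
  assumes "\<And>x y. x \<in> I \<Longrightarrow> y \<in> I \<Longrightarrow> x + y \<in> I" and "0 \<in> I"
    and "\<And>x. x \<in> I \<Longrightarrow> poly p x = 0" and "set xs \<subseteq> I" and "degree p \<le> length xs"
  shows "of_nat (fact (length xs)) * coeff p (length xs) * prod_list xs = 0"
  using assms(3-)
proof (induction xs arbitrary: p)
  case Nil
  \<comment> \<open>What remains is a constant, read off by evaluating at 0 in
    \<open>I\<close>.\<close>
  then show ?case using assms(2) by (auto elim!: degree_eq_zeroE)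
next
  case (Cons x xs)
  let ?q = "pcompose p [:x, 1:] - p"
  have q: "degree ?q \<le> length xs"
    "coeff ?q (length xs) = of_nat (Suc (length xs)) * x * coeff p (Suc (length xs))"
    using coeff_pcompose_shift_diff[of p "length xs" x] Cons.prems(3) by auto
  have "of_nat (fact (length xs)) * coeff ?q (length xs) * prod_list xs = 0"
  proof (rule Cons.IH)
    show "poly ?q y = 0" if "y \<in> I" for y
      using that Cons.prems assms(1)[of x y] by (simp add: poly_pcompose)
  qed (use Cons.prems q in auto)
  then show ?case unfolding q by (simp add: algebra_simps)
qed

text \<open>The annihilator of a is an ideal, so testing generators suffices. The induction varies a
  in order to absorb the first factor into it.\<close>

lemma ideal_pow_annihilated:
  assumes "\<And>xs. set xs \<subseteq> I \<Longrightarrow> length xs = n \<Longrightarrow> a * prod_list xs = 0" and "y \<in> ideal_pow I n"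
  shows "a * y = 0"
  using assms
proof (induction n arbitrary: a y)
  case 0
  from "0.prems"(1)[of "[]"] show ?case by simp
next
  case (Suc n)
  have "ideal_pow I (Suc n) \<subseteq> {z. a * z = 0}"
    unfolding ideal_pow.simps ideal_gen_def
  proof (rule hull_minimal)
    show "{x * y |x y. x \<in> I \<and> y \<in> ideal_pow I n} \<subseteq> {z. a * z = 0}"
    proof safe
      fix x y assume "x \<in> I" "y \<in> ideal_pow I n"
      have "a * x * y = 0"
      proof (rule Suc.IH)
        fix xs assume "set xs \<subseteq> I" "length xs = n"
        then show "a * x * prod_list xs = 0"
          using Suc.prems(1)[of "x # xs"] \<open>x \<in> I\<close> by (simp add: mult.assoc)
      qed fact
      then show "a * (x * y) = 0" by (simp add: mult.assoc)
    qed
    show "ring_ideal {z. a * z = 0}"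
      by (auto simp: ring_ideal_def algebra_simps mult.left_commute)
  qed
  then show ?case using Suc.prems(2) by blast
qed

section \<open>Two-adic arithmetic\<close>

text \<open>By Bezout, z is killed by gcd(m, 2^r) = 2^j; j < r would make 2^(r-1) a multiple of 2^j
  and kill z too early.\<close>

lemma power_2_dvd_of_exact_order:
  fixes z :: "'b::comm_ring_1"
  assumes "2 ^ r * z = 0" and "2 ^ (r - 1) * z \<noteq> 0" and "of_int m * z = 0"
  shows "2 ^ r dvd m"
proof -
  have "gcd m (2 ^ r) dvd 2 ^ r" by simp
  then obtain j where j: "j \<le> r" "gcd m (2 ^ r) = 2 ^ j"
    using divides_primepow_weak[of 2 "gcd m (2 ^ r)" r] by auto
  obtain u v where "u * m + v * 2 ^ r = gcd m (2 ^ r)" using bezout_int by blast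
  then have "(2 :: 'b) ^ j * z = of_int (u * m + v * 2 ^ r) * z" using j by simp
  also have "\<dots> = of_int u * (of_int m * z) + of_int v * (2 ^ r * z)" by (simp add: algebra_simps)
  also have "\<dots> = 0" using assms by simp
  finally have z: "2 ^ j * z = 0" .
  have "j = r"
  proof (rule ccontr)
    assume "j \<noteq> r"
    then have "(2 :: 'b) ^ (r - 1) = 2 ^ (r - 1 - j) * 2 ^ j" using j by (simp flip: power_add)
    then show False using z assms(2) by (simp add: mult.assoc)
  qed
  then show ?thesis using j(2) by (metis gcd_dvd1)
qed

text \<open>The new factor 2m+1 is odd. This is why generators at even exponents also serve the odd
  exponent that follows.\<close>

lemma multiplicity_2_fact_odd:
  "multiplicity 2 (fact (Suc (2 * m)) :: nat) = multiplicity 2 (fact (2 * m) :: nat)"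
  by (simp only: fact_Suc of_nat_id, subst prime_elem_multiplicity_mult_distrib)
     (auto simp: not_dvd_imp_multiplicity_0 simp del: fact_Suc)

text \<open>Legendre's bound, used to compare with the factor 2^(n-1) in the n-th power of a binary
  form.\<close>

lemma multiplicity_2_fact_less: "n > 0 \<Longrightarrow> multiplicity 2 (fact n :: nat) < n"
proof (induction n rule: less_induct)
  case (less n)
  note odd = multiplicity_2_fact_odd
  \<comment> \<open>The m even factors of (2m)! contribute 2^m m!, the others are odd; halving n
    then drives the strong induction.\<close>
  have even: "multiplicity 2 (fact (2 * m) :: nat) = m + multiplicity 2 (fact m :: nat)" for m
  proof (induction m)
    case (Suc m)
    have "(fact (2 * Suc m) :: nat) = 2 * (Suc m * fact (Suc (2 * m)))"
      by (simp add: algebra_simps)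
    then have "multiplicity 2 (fact (2 * Suc m) :: nat)
        = 1 + (multiplicity 2 (Suc m) + multiplicity 2 (fact (Suc (2 * m)) :: nat))"
      by (simp only:) (simp add: prime_elem_multiplicity_mult_distrib del: fact_Suc mult_Suc)
    also have "\<dots> = Suc m + (multiplicity 2 (Suc m) + multiplicity 2 (fact m :: nat))"
      unfolding odd Suc.IH by simp
    also have "multiplicity 2 (Suc m) + multiplicity 2 (fact m :: nat) = multiplicity 2 (fact (Suc m) :: nat)"
      by (simp only: fact_Suc of_nat_id, subst prime_elem_multiplicity_mult_distrib) auto
    finally show ?case .
  qed simp
  show ?case
  proof (cases "even n")
    case True
    then obtain m where "n = 2 * m" by blast
    then show ?thesis using less.IH[of m] less.prems even[of m] by auto
  next
    case False
    then obtain m where m: "n = Suc (2 * m)" by (auto elim: oddE)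
    show ?thesis
    proof (cases "m = 0")
      case False
      then show ?thesis using less.IH[of m] odd[of m] even[of m] unfolding m by linarith
    qed (simp add: m)
  qed
qed

section \<open>Divisibility of powers by the 2-part of the factorial\<close>

text \<open>A 2-local substitute for divided powers x^n/n!: only existence of a quotient is asked,
  as it need not be unique in a ring with 2-torsion.\<close>

definition has_dyadic_divided_powers :: "'b::comm_ring_1 \<Rightarrow> bool" where
  "has_dyadic_divided_powers x \<longleftrightarrow> (\<forall>n. 2 ^ multiplicity 2 (fact n :: nat) dvd x ^ n)"

lemma has_dyadic_divided_powers_0: "has_dyadic_divided_powers 0"
  by (simp add: has_dyadic_divided_powers_def power_0_left)

text \<open>From n! = (n choose j) j! (n-j)!, the required power of 2 splits over the three factors
  of each binomial term.\<close>

lemma has_dyadic_divided_powers_add: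
  assumes "has_dyadic_divided_powers x" and "has_dyadic_divided_powers y"
  shows "has_dyadic_divided_powers (x + y)"
  unfolding has_dyadic_divided_powers_def
proof
  fix n
  let ?v = "\<lambda>n. multiplicity 2 (fact n :: nat)"
  show "2 ^ ?v n dvd (x + y) ^ n"
    unfolding binomial_ring
  proof (rule dvd_sum)
    fix j assume "j \<in> {..n}"
    then have j: "j \<le> n" by simp
    have "fact n = (fact j * fact (n - j)) * (n choose j)"
      using binomial_fact_lemma[OF j] by simp
    then have "?v n = (?v j + ?v (n - j)) + multiplicity 2 (n choose j)"
      using j by (simp add: prime_elem_multiplicity_mult_distrib)
    then have v: "(2 :: 'a) ^ ?v n = 2 ^ multiplicity 2 (n choose j) * 2 ^ ?v j * 2 ^ ?v (n - j)"
      by (simp add: power_add)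
    have "2 ^ multiplicity 2 (n choose j) dvd n choose j" by (rule multiplicity_dvd)
    then have "of_nat (2 ^ multiplicity 2 (n choose j)) dvd (of_nat (n choose j) :: 'a)"
      by (metis dvdE dvd_triv_left of_nat_mult)
    then show "2 ^ ?v n dvd of_nat (n choose j) * x ^ j * y ^ (n - j)"
      unfolding v using assms by (intro mult_dvd_mono) (auto simp: has_dyadic_divided_powers_def)
  qed
qed

text \<open>With \<open>\<beta> = 1 + xy\<close> one has \<open>x + y = x\<beta>\<close> and \<open>\<beta>\<^sup>2 = 2\<beta>\<close>.\<close>

lemma has_dyadic_divided_powers_add_involutions:
  fixes x y :: "'b::comm_ring_1"
  assumes "x * x = 1" and "y * y = 1"
  shows "has_dyadic_divided_powers (x + y)"
  unfolding has_dyadic_divided_powers_def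
proof
  fix n
  have *: "(1 + x * y) ^ Suc m = 2 ^ m * (1 + x * y)" for m
  proof (induction m)
    case (Suc m)
    have "(x * y) * (x * y) = 1" using assms by (metis mult.assoc mult.commute mult_1)
    then have "(1 + x * y) * (1 + x * y) = 2 * (1 + x * y)" by (simp add: algebra_simps)
    then show ?case using Suc by (metis mult.assoc mult.left_commute power_Suc)
  qed simp
  have xy: "x + y = x * (1 + x * y)" using assms(1) by (simp add: algebra_simps flip: mult.assoc)
  show "2 ^ multiplicity 2 (fact n :: nat) dvd (x + y) ^ n"
  proof (cases n)
    case (Suc m)
    then have "2 ^ multiplicity 2 (fact n :: nat) dvd (2 :: 'b) ^ m"
      using multiplicity_2_fact_less[of n] by (intro le_imp_power_dvd) simp
    then show ?thesis unfolding xy power_mult_distrib Suc * by (simp add: dvd_mult dvd_mult2)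
  qed simp
qed

text \<open>Even length allows grouping the involutions in pairs, each pair being a binary
  form.\<close>

lemma has_dyadic_divided_powers_sum_list:
  fixes xs :: "'b::comm_ring_1 list"
  assumes "\<forall>x\<in>set xs. x * x = 1" and "even (length xs)"
  shows "has_dyadic_divided_powers (sum_list xs)"
  using assms
proof (induction xs rule: induct_list012)
  case (3 x y xs)
  then show ?case
    using has_dyadic_divided_powers_add[OF has_dyadic_divided_powers_add_involutions[of x y]]
    by (simp add: add.assoc)
qed (auto simp: has_dyadic_divided_powers_0)

section \<open>Diagonalization of quadratic forms\<close>

lemma congruence_index:
  fixes M P :: "'a::field mat"
  assumes "M \<in> carrier_mat n n" "P \<in> carrier_mat n n" "i < n" "j < n"
  shows "(P\<^sup>T * M * P) $$ (i, j) = (\<Sum>l = 0..<n. (\<Sum>k = 0..<n. P $$ (k, i) * M $$ (k, l)) * P $$ (l, j))"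
  using assms by (simp add: scalar_prod_def del: assoc_mult_mat)

lemma nonsingular_form_congruence:
  fixes A :: "'a::field mat"
  assumes "nonsingular_form A" "A \<in> carrier_mat n n" "P \<in> carrier_mat n n" "det P \<noteq> 0"
  shows "nonsingular_form (P\<^sup>T * A * P)" and "isometric (P\<^sup>T * A * P) A"
proof -
  have c: "P\<^sup>T * A \<in> carrier_mat n n" "P\<^sup>T \<in> carrier_mat n n" using assms by auto
  have "(P\<^sup>T * A * P)\<^sup>T = P\<^sup>T * (A\<^sup>T * P)"
    using assms c by (simp add: transpose_mult[of _ n n _ n])
  also have "\<dots> = P\<^sup>T * A * P"
    using assms by (simp add: nonsingular_form_def assoc_mult_mat[of _ n n _ n _ n])
  finally have "(P\<^sup>T * A * P)\<^sup>T = P\<^sup>T * A * P" .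
  moreover have "det (P\<^sup>T * A * P) \<noteq> 0"
    using assms c by (simp add: det_mult[of _ n] det_transpose nonsingular_form_def)
  ultimately show "nonsingular_form (P\<^sup>T * A * P)"
    using assms by (auto simp: nonsingular_form_def)
  show "isometric (P\<^sup>T * A * P) A"
    using assms c by (intro isometricI[of _ n _ P]) auto
qed

text \<open>Completing the square in the first variable.\<close>

lemma split_off_first_vector:
  fixes A :: "'a::field mat"
  assumes ns: "nonsingular_form A" and A: "A \<in> carrier_mat (Suc n) (Suc n)" and a: "A $$ (0, 0) \<noteq> 0"
  shows "\<exists>B \<in> carrier_mat n n. nonsingular_form B \<and> isometric A (orth_sum (unary_form (A $$ (0, 0))) B)"
proof -
  let ?a = "A $$ (0, 0)" and ?N = "Suc n"
  \<comment> \<open>The Schur complement of the corner entry.\<close>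
  define B where "B = mat n n (\<lambda>(i, j). A $$ (Suc i, Suc j) - A $$ (0, Suc i) * A $$ (0, Suc j) / ?a)"
  \<comment> \<open>The substitution replacing x_0 by the sum of A(0,j) x_j / a; it is upper
    triangular with unit diagonal.\<close>
  define P where "P = mat ?N ?N (\<lambda>(i, j). if i = 0 then A $$ (0, j) / ?a else if i = j then 1 else 0)"
  define M where "M = orth_sum (unary_form ?a) B"
  have sym: "A $$ (i, j) = A $$ (j, i)" if "i < ?N" "j < ?N" for i j
    using ns A that by (metis carrier_matD index_transpose_mat(1) nonsingular_form_def)
  have B: "B \<in> carrier_mat n n" and P: "P \<in> carrier_mat ?N ?N" by (auto simp: B_def P_def)
  have M: "M \<in> carrier_mat ?N ?N" using orth_sum_carrier[OF unary_form_carrier B] by (simp add: M_def)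
  have "upper_triangular P" by (auto simp: P_def)
  moreover have "0 \<notin> set (diag_mat P)" using a by (auto simp: diag_mat_def P_def)
  ultimately have dP: "det P \<noteq> 0" using upper_triangular_imp_det_eq_0_iff[OF P] by blast
  have "A = P\<^sup>T * M * P"
  proof (rule eq_matI)
    fix i j assume "i < dim_row (P\<^sup>T * M * P)" "j < dim_col (P\<^sup>T * M * P)"
    then have ij: "i < ?N" "j < ?N" using P by auto
    have M0: "M $$ (0, 0) = ?a" "M $$ (0, Suc l) = 0" "M $$ (Suc l, 0) = 0"
      "M $$ (Suc k, Suc l) = B $$ (k, l)" if "l < n" "k < n" for k l
      using that B by (auto simp: M_def orth_sum_index)
    have M00: "M $$ (0, 0) = ?a" using B by (auto simp: M_def orth_sum_index)
    \<comment> \<open>Row i of \<open>P\<^sup>T * M\<close>: column 0 receives a * (A(0,i) / a), the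
      other columns copy row i-1 of \<open>B\<close>, or vanish if i = 0.\<close>
    have PM: "(\<Sum>k = 0..<?N. P $$ (k, i) * M $$ (k, l)) =
        (if l = 0 then A $$ (0, i) else if i = 0 then 0 else B $$ (i - 1, l - 1))" if l: "l < ?N" for l
    proof (cases l)
      case 0
      then show ?thesis using ij a
        by (simp only: sum.atLeast0_lessThan_Suc_shift) (simp add: M0 M00 P_def)
    next
      case (Suc l')
      then have "(\<Sum>k = 0..<?N. P $$ (k, i) * M $$ (k, l)) =
          (\<Sum>k = 0..<n. if k = i - 1 then (if i = 0 then 0 else B $$ (i - 1, l')) else 0)"
        using ij l by (simp only: sum.atLeast0_lessThan_Suc_shift)
          (auto simp: M0 P_def simp del: sum.delta sum.delta' intro!: sum.cong)
      then show ?thesis using Suc ij by auto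
    qed
    have "(P\<^sup>T * M * P) $$ (i, j) = A $$ (0, i) * A $$ (0, j) / ?a +
        (\<Sum>l = 0..<n. (if i = 0 then 0 else B $$ (i - 1, l)) * P $$ (Suc l, j))"
    proof -
      have "(P\<^sup>T * M * P) $$ (i, j) =
          (\<Sum>l = 0..<?N. (if l = 0 then A $$ (0, i) else if i = 0 then 0 else B $$ (i - 1, l - 1)) * P $$ (l, j))"
        unfolding congruence_index[OF M P ij] by (intro sum.cong refl) (simp only: PM atLeastLessThan_iff)
      also have "\<dots> = A $$ (0, i) * P $$ (0, j) +
          (\<Sum>l = 0..<n. (if i = 0 then 0 else B $$ (i - 1, l)) * P $$ (Suc l, j))"
        by (simp only: sum.atLeast0_lessThan_Suc_shift) (simp cong: if_cong)
      finally show ?thesis using ij by (simp add: P_def)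
    qed
    also have "(\<Sum>l = 0..<n. (if i = 0 then 0 else B $$ (i - 1, l)) * P $$ (Suc l, j)) =
        (\<Sum>l = 0..<n. if l = j - 1 then (if i = 0 \<or> j = 0 then 0 else B $$ (i - 1, j - 1)) else 0)"
      using ij by (intro sum.cong) (auto simp: P_def)
    also have "\<dots> = (if i = 0 \<or> j = 0 then 0 else B $$ (i - 1, j - 1))" using ij by auto
    also have "A $$ (0, i) * A $$ (0, j) / ?a + \<dots> = A $$ (i, j)"
      using ij a sym[of i 0] by (cases i; cases j) (auto simp: B_def)
    finally show "A $$ (i, j) = (P\<^sup>T * M * P) $$ (i, j)" ..
  qed (use A P in auto)
  then have iso: "isometric A M" using A M P dP by (intro isometricI) auto
  \<comment> \<open>Since det M = a det B, nonsingularity passes from \<open>A\<close> to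
    \<open>B\<close>.\<close>
  have "det A = det P * det M * det P"
    using P M by (simp add: \<open>A = P\<^sup>T * M * P\<close> det_mult[of _ ?N] det_transpose)
  then have "det M \<noteq> 0" using ns by (auto simp: nonsingular_form_def)
  moreover have "det M = ?a * det B"
    unfolding M_def orth_sum_def using B
    by (subst det_four_block_mat_lower_left_zero[of _ 1 _ n]) (auto simp: det_single unary_form_def)
  ultimately have "det B \<noteq> 0" by auto
  moreover have "B\<^sup>T = B"
    using sym by (intro eq_matI) (auto simp: B_def)
  ultimately have "nonsingular_form B" using B by (auto simp: nonsingular_form_def)
  then show ?thesis using iso B by (auto simp: M_def)
qed

text \<open>If the diagonal vanishes, some off-diagonal entry A(i,j) does not, and the form takes
  the value 2 A(i,j) at e_i + e_j, nonzero as the characteristic is not 2.\<close>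

lemma nonsingular_form_nonzero_diagonal:
  fixes A :: "'a::field_char_neq_2 mat"
  assumes ns: "nonsingular_form A" and A: "A \<in> carrier_mat n n" and "n > 0"
  shows "\<exists>A' j. A' \<in> carrier_mat n n \<and> nonsingular_form A' \<and> isometric A A' \<and> j < n \<and> A' $$ (j, j) \<noteq> 0"
proof (cases "\<exists>j<n. A $$ (j, j) \<noteq> 0")
  case True
  then show ?thesis using assms isometric_refl by blast
next
  case False
  then have diag: "A $$ (j, j) = 0" if "j < n" for j using that by blast
  have sym: "A $$ (i, j) = A $$ (j, i)" if "i < n" "j < n" for i j
    using ns A that by (metis carrier_matD index_transpose_mat(1) nonsingular_form_def)
  have "\<exists>i<n. \<exists>j<n. A $$ (i, j) \<noteq> 0"
  proof (rule ccontr)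
    assume *: "\<not> ?thesis"
    obtain B where B: "B \<in> carrier_mat n n" "A * B = 1\<^sub>m n"
      using det_nonzero_inverse[OF A] ns by (auto simp: nonsingular_form_def)
    have "(A * B) $$ (0, 0) = (\<Sum>k = 0..<n. A $$ (0, k) * B $$ (k, 0))"
      using A B(1) \<open>n > 0\<close> by (simp add: scalar_prod_def)
    also have "\<dots> = 0" using * \<open>n > 0\<close> by simp
    finally have "(A * B) $$ (0, 0) = 0" .
    then show False using B \<open>n > 0\<close> by simp
  qed
  then obtain i j where ij: "i < n" "j < n" "A $$ (i, j) \<noteq> 0" by blast
  then have "i \<noteq> j" using diag by auto
  \<comment> \<open>Column j of \<open>P\<close> is e_i + e_j, so the new (j,j) entry is the value
    at that vector.\<close>
  define P :: "'a mat" where "P = addrow_mat n 1 i j"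
  have P: "P \<in> carrier_mat n n" "det P \<noteq> 0"
    using det_addrow_mat[OF \<open>i \<noteq> j\<close>, of n "1 :: 'a"] by (auto simp: P_def)
  have Pj: "P $$ (l, j) = (if l = i then 1 else 0) + (if l = j then 1 else 0)" if "l < n" for l
    using that ij \<open>i \<noteq> j\<close> by (auto simp: P_def)
  have "(P\<^sup>T * A * P) $$ (j, j) = (\<Sum>l = 0..<n. (\<Sum>k = 0..<n. P $$ (k, j) * A $$ (k, l)) * P $$ (l, j))"
    using A P ij by (intro congruence_index) auto
  also have "\<dots> = (\<Sum>l = 0..<n. (A $$ (i, l) + A $$ (j, l)) * P $$ (l, j))"
    using ij by (intro sum.cong refl) (auto simp: Pj algebra_simps sum.distrib if_distrib[of "\<lambda>c. _ * c"] cong: if_cong)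
  also have "\<dots> = (A $$ (i, i) + A $$ (j, i)) + (A $$ (i, j) + A $$ (j, j))"
    using ij by (auto simp: Pj distrib_left sum.distrib if_distrib[of "\<lambda>c. _ * c"] cong: if_cong)
  also have "\<dots> = 2 * A $$ (i, j)" using ij diag sym[of j i] by simp
  also have "\<dots> \<noteq> 0" using ij two_neq_zero by simp
  finally show ?thesis
    using nonsingular_form_congruence[OF ns A P] A P ij isometric_sym
    by (intro exI[of _ "P\<^sup>T * A * P"] exI[of _ j]) auto
qed

lemma nonsingular_form_split_unary:
  fixes A :: "'a::field_char_neq_2 mat"
  assumes ns: "nonsingular_form A" and A: "A \<in> carrier_mat (Suc n) (Suc n)"
  shows "\<exists>a B. a \<noteq> 0 \<and> B \<in> carrier_mat n n \<and> nonsingular_form B \<and> isometric A (orth_sum (unary_form a) B)"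
proof -
  obtain A' j where A': "A' \<in> carrier_mat (Suc n) (Suc n)" "nonsingular_form A'" "isometric A A'"
    "j < Suc n" "A' $$ (j, j) \<noteq> 0"
    using nonsingular_form_nonzero_diagonal[OF ns A] by auto
  \<comment> \<open>Swapping basis vectors 0 and j brings the nonzero entry to the corner.\<close>
  let ?f = "Transposition.transpose 0 j"
  have f: "?f i < Suc n" if "i < Suc n" for i using that A'(4) by (auto simp: transpose_def)
  define C where "C = mat (Suc n) (Suc n) (\<lambda>(i, l). A' $$ (?f i, ?f l))"
  have C: "C \<in> carrier_mat (Suc n) (Suc n)" by (simp add: C_def)
  have iso: "isometric C A'"
    by (rule isometric_reindex[OF A'(1) f _ C]) (auto simp: C_def intro: inj_on_subset[OF inj_transpose])
  then obtain m P where P: "A' \<in> carrier_mat m m" "P \<in> carrier_mat m m" "det P \<noteq> 0" "C = P\<^sup>T * A' * P"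
    by (auto elim: isometricE)
  have "nonsingular_form C" using nonsingular_form_congruence(1)[OF A'(2) P(1-3)] P(4) by simp
  moreover have "C $$ (0, 0) \<noteq> 0" using A' by (simp add: C_def)
  ultimately obtain B where "B \<in> carrier_mat n n" "nonsingular_form B"
    "isometric C (orth_sum (unary_form (C $$ (0, 0))) B)"
    using split_off_first_vector[OF _ C] by blast
  then show ?thesis
    using \<open>C $$ (0, 0) \<noteq> 0\<close> isometric_trans[OF isometric_trans[OF A'(3) isometric_sym[OF iso]]] by blast
qed

text \<open>The product is the form <a^2>, which becomes <1> on rescaling the basis vector by
  a.\<close>

lemma unary_witt_class_square:
  fixes a :: "'a::field_char_neq_2"
  assumes "a \<noteq> 0"
  shows "witt_class (unary_form a) * witt_class (unary_form a) = 1"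
proof -
  have "tensor_form (unary_form a) (unary_form a) = (unary_form a)\<^sup>T * unary_form 1 * unary_form a"
    by (rule eq_matI) (auto simp: tensor_form_index scalar_prod_def unary_form_def)
  then have "isometric (tensor_form (unary_form a) (unary_form a)) (unary_form 1)"
    using nonsingular_unary[OF assms]
    by (intro isometricI[of _ 1 _ "unary_form a"]) (auto simp: nonsingular_form_def)
  then have "witt_equiv (tensor_form (unary_form a) (unary_form a)) (unary_form 1)"
    using assms by (intro isometric_imp_witt_equiv nonsingular_tensor_form nonsingular_unary) auto
  then show ?thesis
    using assms
    by (simp add: times_witt.abs_eq witt_equiv_refl nonsingular_unary one_witt.abs_eq Quotient3_rel_abs[OF Quotient3_witt])
qed

text \<open>Repeated splitting turns a form into a sum of as many involutions of the Witt ring as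
  its dimension; the divisibility argument needs nothing else about forms.\<close>

lemma witt_class_diagonal:
  fixes A :: "'a::field_char_neq_2 mat"
  assumes "nonsingular_form A" and "A \<in> carrier_mat n n"
  shows "\<exists>xs. length xs = n \<and> (\<forall>x\<in>set xs. x * x = 1) \<and> witt_class A = sum_list xs"
  using assms
proof (induction n arbitrary: A)
  case 0
  then have "A = 0\<^sub>m 0 0" by auto
  then show ?case by (simp add: zero_witt.abs_eq)
next
  case (Suc n)
  obtain a B where a: "a \<noteq> 0" and B: "B \<in> carrier_mat n n" "nonsingular_form B"
    and iso: "isometric A (orth_sum (unary_form a) B)"
    using nonsingular_form_split_unary[OF Suc.prems] by blast
  obtain xs where xs: "length xs = n" "\<forall>x\<in>set xs. x * x = 1" "witt_class B = sum_list xs"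
    using Suc.IH[OF B(2,1)] by blast
  have "witt_equiv A (orth_sum (unary_form a) B)"
    using Suc.prems a B iso by (intro isometric_imp_witt_equiv nonsingular_orth_sum nonsingular_unary)
  then have "witt_class A = witt_class (unary_form a) + witt_class B"
    using a B by (simp add: plus_witt.abs_eq witt_equiv_refl nonsingular_unary Quotient3_rel_abs[OF Quotient3_witt])
  then show ?case
    using xs unary_witt_class_square[OF a] by (intro exI[of _ "witt_class (unary_form a) # xs"]) auto
qed

section \<open>Powers of torsion elements and the inclusion of the ideal in the annihilator\<close>

lemma fundamental_ideal_divided_powers:
  assumes "x \<in> fundamental_ideal TYPE('a::field_char_neq_2)"
  shows "has_dyadic_divided_powers x"
proof -
  obtain A where "nonsingular_form A" "even (dim_row A)" "x = witt_class A"
    using assms by (auto simp: fundamental_ideal_def)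
  then show ?thesis
    using witt_class_diagonal[OF _ nonsingular_carrier, of A] has_dyadic_divided_powers_sum_list by metis
qed

text \<open>Write x^n = 2^v w with v = nu_2(n!). If m x = 0 then m 2^v w = m x^n = 0, since n > 0;
  so w is torsion and 2^r w = 0.\<close>

lemma torsion_fundamental_ideal_power:
  assumes tors: "(*) (2 ^ r) ` witt_torsion TYPE('a::field_char_neq_2) = {0}"
    and x: "x \<in> torsion_fundamental_ideal TYPE('a)" and "n > 0"
  shows "2 ^ (r - multiplicity 2 (fact n :: nat)) * x ^ n = 0"
proof -
  let ?v = "multiplicity 2 (fact n :: nat)"
  obtain w where w: "x ^ n = 2 ^ ?v * w"
    using fundamental_ideal_divided_powers[of x] x
    by (auto simp: torsion_fundamental_ideal_def has_dyadic_divided_powers_def elim: dvdE)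
  obtain m where m: "m > 0" "of_nat m * x = 0"
    using x by (auto simp: torsion_fundamental_ideal_def witt_torsion_def)
  have "of_nat (m * 2 ^ ?v) * w = of_nat m * x ^ n" by (simp add: w mult.assoc)
  also have "\<dots> = of_nat m * x * x ^ (n - 1)" using \<open>n > 0\<close> by (simp add: power_eq_if mult.assoc)
  finally have "of_nat (m * 2 ^ ?v) * w = 0" using m by simp
  then have "w \<in> witt_torsion TYPE('a)"
    using m by (auto simp: witt_torsion_def intro!: exI[of _ "m * 2 ^ ?v"])
  then have rw: "2 ^ r * w = 0" using tors by blast
  \<comment> \<open>Covers both truncations: the product is 2^max(r, v), a multiple of 2^r.\<close>
  have "(2 :: 'a witt) ^ (r - ?v) * 2 ^ ?v = 2 ^ (?v - r) * 2 ^ r"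
    by (cases "?v \<le> r") (simp_all flip: power_add)
  then have "2 ^ (r - ?v) * x ^ n = 2 ^ (?v - r) * (2 ^ r * w)"
    unfolding w by (simp flip: mult.assoc)
  then show ?thesis using rw by simp
qed

lemma torsion_annihilator'_iff:
  "f \<in> torsion_annihilator' TYPE('a::field_char_neq_2) \<longleftrightarrow>
    coeff f 0 = 0 \<and> (\<forall>x\<in>torsion_fundamental_ideal TYPE('a). eval_int_poly f x = 0)"
proof -
  have "(\<exists>g. f = [:0, 1:] * g) \<longleftrightarrow> coeff f 0 = 0"
    by (cases f) auto
  then show ?thesis by (auto simp: torsion_annihilator'_def torsion_annihilator_def)
qed

lemma ring_ideal_torsion_annihilator':
  "ring_ideal (torsion_annihilator' TYPE('a::field_char_neq_2))"
  by (auto simp: ring_ideal_def torsion_annihilator'_iff eval_int_poly_simps coeff_mult)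

lemma J'_e_subset_torsion_annihilator':
  assumes tors: "(*) (2 ^ r) ` witt_torsion TYPE('a::field_char_neq_2) = {0}"
    and k: "k > 0" "r \<le> multiplicity 2 (fact (2 * k) :: nat)"
  shows "J'_e r k \<subseteq> torsion_annihilator' TYPE('a)"
  unfolding J'_e_def ideal_gen_def
proof (rule hull_minimal)
  show "ring_ideal (torsion_annihilator' TYPE('a))" by (rule ring_ideal_torsion_annihilator')
  note pow = torsion_fundamental_ideal_power[OF tors]
  have "2 ^ r * x = 0" if "x \<in> torsion_fundamental_ideal TYPE('a)" for x
    using pow[OF that, of 1] by simp
  \<comment> \<open>Here r is at most nu_2((2k)!), so the exponent of 2 truncates to 0.\<close>
  moreover have "x ^ (2 * k) = 0" if "x \<in> torsion_fundamental_ideal TYPE('a)" for x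
    using pow[OF that, of "2 * k"] k by simp
  ultimately show "{monom (2 ^ r) 1}
     \<union> {monom (2 ^ (r - multiplicity 2 (fact (2 * i) :: nat))) (2 * i) | i. 1 \<le> i \<and> i \<le> k - 1}
     \<union> {monom 1 (2 * k)} \<subseteq> torsion_annihilator' TYPE('a)"
    using k by (auto simp: torsion_annihilator'_iff eval_int_poly_simps pow)
qed

section \<open>The reverse inclusion\<close>

text \<open>Each monomial is a multiple of one generator: X^(2k) if n is at least 2k, 2^r X if n =
  1, otherwise the generator at the largest even exponent not exceeding n.\<close>

lemma monom_in_J'_e:
  assumes "n > 0" and c: "n < 2 * k \<Longrightarrow> 2 ^ (r - multiplicity 2 (fact n :: nat)) dvd c"
  shows "monom c n \<in> J'_e r k"
proof -
  have mult: "monom c' n \<in> J'_e r k"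
    if "monom d m \<in> J'_e r k" "d dvd c'" "m \<le> n" for c' d m
  proof -
    obtain e where "c' = d * e" using \<open>d dvd c'\<close> by (rule dvdE)
    then have "monom c' n = monom e (n - m) * monom d m" using that by (simp add: mult_monom)
    moreover have "g * f \<in> J'_e r k" if "f \<in> J'_e r k" for f g
      using that ring_ideal_ideal_gen unfolding J'_e_def ring_ideal_def by blast
    ultimately show ?thesis using that by simp
  qed
  have gen: "f \<in> J'_e r k" if "f \<in> {monom (2 ^ r) 1}
     \<union> {monom (2 ^ (r - multiplicity 2 (fact (2 * i) :: nat))) (2 * i) | i. 1 \<le> i \<and> i \<le> k - 1}
     \<union> {monom 1 (2 * k)}" for f
    using that unfolding J'_e_def ideal_gen_def by (rule hull_inc)
  show ?thesis
  proof (cases "n < 2 * k")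
    case False
    then show ?thesis using mult[of 1 "2 * k" c] gen by simp
  next
    case True
    define i where "i = n div 2"
    have n: "n = 2 * i \<or> n = Suc (2 * i)" by (auto simp: i_def)
    have v: "multiplicity 2 (fact n :: nat) = multiplicity 2 (fact (2 * i) :: nat)"
      using n by (auto simp: multiplicity_2_fact_odd simp del: fact_Suc)
    show ?thesis
    proof (cases "i = 0")
      case True
      then have "2 ^ r dvd c" using c[OF \<open>n < 2 * k\<close>] v by simp
      then show ?thesis using mult[of "2 ^ r" 1 c] gen \<open>n > 0\<close> by simp
    next
      case False
      then have "1 \<le> i" "i \<le> k - 1" using n \<open>n < 2 * k\<close> by auto
      then have "monom (2 ^ (r - multiplicity 2 (fact (2 * i) :: nat))) (2 * i) \<in> J'_e r k"
        by (intro gen) blast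
      then show ?thesis using c[OF \<open>n < 2 * k\<close>] n unfolding v by (intro mult) auto
    qed
  qed
qed

text \<open>Polarization along the first n entries of \<open>xs\<close> kills n! c times their
  product, where c is the coefficient at n. That product has additive order exactly 2^r, so 2^r
  divides n! c; cancelling the 2-part of n! leaves the claim.\<close>

lemma torsion_annihilator_lead_coeff_dvd:
  fixes f :: "int poly"
  assumes tors: "(*) (2 ^ r) ` witt_torsion TYPE('a::field_char_neq_2) = {0}"
    and xs: "set xs \<subseteq> torsion_fundamental_ideal TYPE('a)" "2 ^ (r - 1) * prod_list xs \<noteq> 0"
    and f: "\<And>x. x \<in> torsion_fundamental_ideal TYPE('a) \<Longrightarrow> eval_int_poly f x = 0"
    and n: "degree f \<le> n" "n > 0" "n \<le> length xs"
  shows "2 ^ (r - multiplicity 2 (fact n :: nat)) dvd coeff f n"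
proof -
  let ?I = "torsion_fundamental_ideal TYPE('a)" and ?v = "multiplicity 2 (fact n :: nat)"
  have I: "0 \<in> ?I" "\<And>x y. x \<in> ?I \<Longrightarrow> y \<in> ?I \<Longrightarrow> x + y \<in> ?I" "\<And>c x. x \<in> ?I \<Longrightarrow> c * x \<in> ?I"
    using ring_ideal_torsion_fundamental_ideal unfolding ring_ideal_def by auto
  define ys where "ys = take n xs"
  define p :: "'a witt poly" where "p = map_poly of_int f"
  have ys: "set ys \<subseteq> ?I" "length ys = n"
    using xs n set_take_subset[of n xs] by (auto simp: ys_def)
  have "degree p \<le> n"
    unfolding p_def using n by (intro degree_le) (auto simp: coeff_map_poly coeff_eq_0)
  then have "of_nat (fact (length ys)) * coeff p (length ys) * prod_list ys = 0"
    using f ys by (intro polarization_annihilates[where I = ?I] I) (auto simp: p_def eval_int_poly_def)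
  then have "of_int (int (fact n) * coeff f n) * prod_list ys = 0"
    using ys by (simp only: of_int_mult of_int_of_nat_eq) (simp add: p_def coeff_map_poly)
  \<comment> \<open>A partial product divides the full one, so it cannot be killed earlier.\<close>
  moreover have "2 ^ (r - 1) * prod_list ys \<noteq> 0"
  proof
    assume "2 ^ (r - 1) * prod_list ys = 0"
    moreover have "prod_list xs = prod_list ys * prod_list (drop n xs)"
      unfolding ys_def by (metis append_take_drop_id prod_list.append)
    ultimately show False using xs(2) by (simp flip: mult.assoc)
  qed
  \<comment> \<open>As n > 0 the product has at least one factor, which lies in the ideal.\<close>
  moreover have "prod_list ys \<in> ?I"
    using ys n I(3)[of "hd ys" "prod_list (tl ys)"] by (cases ys) (auto simp: mult.commute)
  then have "2 ^ r * prod_list ys = 0"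
    using tors by (auto simp: torsion_fundamental_ideal_def)
  ultimately have dvd: "2 ^ r dvd int (fact n) * coeff f n" by (intro power_2_dvd_of_exact_order) auto
  have "(fact n :: nat) \<noteq> 0" "\<not> is_unit (2 :: nat)" by simp_all
  then obtain m :: nat where m: "fact n = 2 ^ ?v * m" "odd m" by (rule multiplicity_decompose')
  show ?thesis
  proof (cases "?v \<le> r")
    case True
    have "int (fact n) = 2 ^ ?v * int m"
      using m(1) by (metis of_nat_mult of_nat_numeral of_nat_power)
    moreover have "(2 :: int) ^ r = 2 ^ ?v * 2 ^ (r - ?v)" using True by (simp flip: power_add)
    ultimately have "2 ^ ?v * 2 ^ (r - ?v) dvd 2 ^ ?v * (int m * coeff f n)"
      using dvd by (simp only: mult.assoc)
    then have "2 ^ (r - ?v) dvd int m * coeff f n" by simp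
    moreover have "coprime ((2 :: int) ^ (r - ?v)) (int m)" using m(2) by simp
    ultimately show ?thesis by (simp add: coprime_dvd_mult_right_iff)
  qed simp
qed

theorem mainTheorem6:
  fixes r k :: nat
  assumes "r \<ge> 1"
    and "multiplicity 2 (fact (2 * k - 2) :: nat) < r"
    and "r \<le> multiplicity 2 (fact (2 * k) :: nat)"
    and "(*) (2 ^ r) ` witt_torsion TYPE('a::field_char_neq_2) = {0}"
    and "(*) (2 ^ (r - 1)) ` ideal_pow (torsion_fundamental_ideal TYPE('a)) (2 * k - 1) \<noteq> {0}"
  shows "torsion_annihilator' TYPE('a) = J'_e r k"
proof
  let ?I = "torsion_fundamental_ideal TYPE('a)" and ?A = "torsion_annihilator' TYPE('a)"
  have k: "k > 0" using assms(1,3) by (cases k) auto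
  show sub: "J'_e r k \<subseteq> ?A"
    using J'_e_subset_torsion_annihilator'[OF assms(4) k assms(3)] .
  \<comment> \<open>If 2^(r-1) killed every such product, it would kill the whole ideal
    power.\<close>
  have "\<exists>xs. set xs \<subseteq> ?I \<and> length xs = 2 * k - 1 \<and> 2 ^ (r - 1) * prod_list xs \<noteq> 0"
  proof (rule ccontr)
    assume "\<not> ?thesis"
    then have "\<And>xs. set xs \<subseteq> ?I \<Longrightarrow> length xs = 2 * k - 1 \<Longrightarrow> 2 ^ (r - 1) * prod_list xs = 0"
      by blast
    then have "2 ^ (r - 1) * y = 0" if "y \<in> ideal_pow ?I (2 * k - 1)" for y
      using that by (rule ideal_pow_annihilated)
    moreover have "0 \<in> ideal_pow ?I (2 * k - 1)"
      using ring_ideal_ideal_gen by (cases "2 * k - 1") (auto simp: ring_ideal_def)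
    ultimately have "(*) (2 ^ (r - 1)) ` ideal_pow ?I (2 * k - 1) = {0}"
      by (auto intro!: image_eqI[of _ _ 0])
    then show False using assms(5) by contradiction
  qed
  then obtain xs where xs: "set xs \<subseteq> ?I" "length xs = 2 * k - 1" "2 ^ (r - 1) * prod_list xs \<noteq> 0"
    by blast
  \<comment> \<open>The induction is on a degree bound, since removing the top term may lower the
    degree by more than one.\<close>
  have "f \<in> J'_e r k" if "f \<in> ?A" "degree f \<le> n" for f n
    using that
  proof (induction n arbitrary: f)
    case 0
    then have "f = 0" by (auto simp: torsion_annihilator'_iff elim!: degree_eq_zeroE)
    then show ?case using ring_ideal_ideal_gen by (auto simp: J'_e_def ring_ideal_def)
  next
    case (Suc n)
    let ?m = "monom (coeff f (Suc n)) (Suc n)"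
    have m: "?m \<in> J'_e r k"
    proof (rule monom_in_J'_e)
      \<comment> \<open>Then \<open>Suc n\<close> is at most 2k-1, the number of factors available
        in \<open>xs\<close>.\<close>
      assume "Suc n < 2 * k"
      then show "2 ^ (r - multiplicity 2 (fact (Suc n) :: nat)) dvd coeff f (Suc n)"
        using xs Suc.prems k
        by (intro torsion_annihilator_lead_coeff_dvd[OF assms(4), of xs])
           (auto simp: torsion_annihilator'_iff)
    qed simp
    have "degree (f - ?m) \<le> n"
    proof (rule degree_le, intro allI impI)
      fix i assume "n < i"
      then show "coeff (f - ?m) i = 0" using Suc.prems(2) by (cases "i = Suc n") (auto simp: coeff_eq_0)
    qed
    \<comment> \<open>The inclusion already proved puts the removed monomial in the
      annihilator.\<close>
    moreover have "f - ?m \<in> ?A"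
      using Suc.prems(1) m sub by (auto simp: torsion_annihilator'_iff eval_int_poly_simps)
    ultimately have "f - ?m \<in> J'_e r k" using Suc.IH by blast
    then have "(f - ?m) + ?m \<in> J'_e r k"
      using m ring_ideal_ideal_gen unfolding J'_e_def ring_ideal_def by blast
    then show ?case by simp
  qed
  then show "?A \<subseteq> J'_e r k" by blast
qed

end
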